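(* Consider the uncertain closed-loop system $x(t+1)=A_d x(t)+B_d\pi(x(t))$ with $A_d\in[\underline A_d,\overline A_d]\subset\mathbb R^{n\times n}$, $B_d\in[\underline B_d,\overline B_d]\subset\mathbb R^{n\times m}$, where $\pi$ is the given $\ell$-layer feedforward network with $\pi(0)=0$. Let $x_*=0$, $u_*=0$, and let $v_*,w_*\in\mathbb R^{n_\phi}$ be the corresponding equilibrium activation inputs and outputs. Let $\overline v^1\in\mathbb R^{n_1}$ with $\overline v^1\ge v_*^1$, put $\underline v^1:=2v_*^1-\overline v^1$, and let $\underline v\le v_*\le\overline v$ in $\mathbb R^{n_\phi}$ be vectors whose first-layer blocks are $\underline v^1,\overline v^1$ and such that for every $x\in\mathbb R^n$ with $\underline v^1\le W^1x+b^1\le\overline v^1$ the network's concatenated activation input $v_\phi$ at $x$ satisfies $\underline v\le v_\phi\le\overline v$. Let $\alpha_\phi\le\beta_\phi$ in $\mathbb R^{n_\phi}$ be such that $\phi$ is locally sector-bounded in the sector $[\alpha_\phi,\beta_\phi]$ around $(v_*,w_* )$ entrywise for all $v_\phi\in[\underline v,\overline v]$. Suppose there exist a symmetric positive definite $P\in\mathbb R^{n\times n}$ and $\lambda\in\mathbb R^{n_\phi}_{\ge0}$ such that $$\begin{bmatrix}(\overline v_i^1-v_{*,i}^1)^2 & W_i^1\\ (W_i^1)^\top & P\end{bmatrix}\succeq 0\quad\text{for all } i\in\{1,\dots,n_1\},$$ where $W_i^1$ is the $i$-th row of $W^1$, and $$\begin{bmatrix}-R_V^\top\begin{bmatrix}I_n\\0_{m\times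 n}\end{bmatrix}P\begin{bmatrix}I_n&0_{n\times m}\end{bmatrix}R_V+X(\lambda) & *\\ P\begin{bmatrix}A_d&B_d\end{bmatrix}R_V&-P\end{bmatrix}\prec0$$ for every $A_d\in\mathrm{vertex}([\underline A_d,\overline A_d])$ and every $B_d\in\mathrm{vertex}([\underline B_d,\overline B_d])$. Then: (i) the uncertain closed-loop system is locally stable around $x_*=0$; and (ii) the set $\mathcal E(P,x_* )=\{x\in\mathbb R^n: (x-x_* )^\top P(x-x_* )\le1\}$ is contained in the robust region of attraction $$\tilde{\mathcal R}=\Big\{x\in\mathbb R^n:\ \lim_{t\to\infty}\mathscr X(t,x,A_d,B_d)=x_*\ \ \forall A_d\in[\underline A_d,\overline A_d],\ \forall B_d\in[\underline B_d,\overline B_d]\Big\}.$$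
   Context: Inequalities $\le,\ge$ between vectors or matrices are entrywise; $\prec,\preceq,\succ,\succeq$ refer to definiteness of symmetric matrices; $*$ denotes a block determined by symmetry. Interval matrices: for $\underline A\le\overline A$, $[\underline A,\overline A]$ is the set of matrices $A$ with $\underline A(i,j)\le A(i,j)\le\overline A(i,j)$ for all $i,j$; $\mathrm{vertex}([\underline A,\overline A])$ is the set of matrices $A$ with each $A(i,j)\in\{\underline A(i,j),\overline A(i,j)\}$. Network: $\pi:\mathbb R^n\to\mathbb R^m$ is given by $w^0=x$, $v^i=W^iw^{i-1}+b^i$, $w^i=\phi^i(v^i)$ for $i=1,\dots,\ell$, $\pi(x)=W^{\ell+1}w^\ell+b^{\ell+1}$, with $n_0=n$, $W^i\in\mathbb R^{n_i\times n_{i-1}}$, $b^i\in\mathbb R^{n_i}$ for $i\le\ell$, $W^{\ell+1}\in\mathbb R^{m\times n_\ell}$, $b^{\ell+1}\in\mathbb R^m$, and $\phi^i$ applying a scalar activation function $\varphi:\mathbb R\to\mathbb R$ entrywise. It is assumed that $\pi(0)=0$. Let $n_\phi=\sum_{i=1}^\ell n_i$, let $v_\phi,w_\phi\in\mathbb R^{n_\phi}$ be the stacked vectors $(v^1,\dots,v^\ell)$, $(w^1,\dots,w^\ell)$, and let $\phi:\mathbb R^{n_\phi}\to\mathbb R^{n_\phi}$ apply $\varphi$ entrywise, so $w_\phi=\phi(v_\phi)$. The vectors $v_*=(v_*^1,\dots,v_*^\ell)$ and $w_*=\phi(v_* )$ are the values of $v_\phi,w_\phi$ at input $x=0$; $v_{*,i}^1$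 and $\overline v_i^1$ are the $i$-th entries of $v_*^1$ and $\overline v^1$. The matrices $N_{vx},N_{vw},N_{ux},N_{uw}$ are defined by writing $v_\phi=N_{vx}x+N_{vw}w_\phi+N_{vb}$ and $u=\pi(x)=N_{ux}x+N_{uw}w_\phi+N_{ub}$: $N_{vx}\in\mathbb R^{n_\phi\times n}$ has first block row $W^1$ and all other block rows zero; $N_{vw}\in\mathbb R^{n_\phi\times n_\phi}$ has block $W^{i}$ in block position $(i,i-1)$ for $i=2,\dots,\ell$ and zeros elsewhere; $N_{ux}=0_{m\times n}$; $N_{uw}=[0\ \cdots\ 0\ W^{\ell+1}]\in\mathbb R^{m\times n_\phi}$. Local sector bound: a scalar function $\varphi$ is locally sector-bounded in $[\alpha,\beta]$ around $(v_*,\varphi(v_* ))$ on $[\underline v,\overline v]\ni v_*$ if $(\Delta\varphi(v)-\alpha\Delta v)(\Delta\varphi(v)-\beta\Delta v)\le0$ for all $v\in[\underline v,\overline v]$, where $\Delta\varphi(v)=\varphi(v)-\varphi(v_* )$, $\Delta v=v-v_*$. For $\phi$ this is required in each coordinate with the corresponding entries of $\alpha_\phi,\beta_\phi,\underline v,\overline v,v_*$. Matrices: $$R_V=\begin{bmatrix}I_n&0_{n\times n_\phi}\\N_{ux}&N_{uw}\end{bmatrix},\quad R_\phi=\begin{bmatrix}N_{vx}&N_{vw}\\0_{n_\phi\times n}&I_{n_\phi}\end{bmatrix},\quad \Psi_\phi=\begin{bmatrix}\operatorname{diag}(\beta_\phi)&-I_{n_\phi}\\-\operatorname{diag}(\alpha_\phi)&I_{n_\phi}\end{bmatrix},$$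 $$M_\phi(\lambda)=\begin{bmatrix}0&\operatorname{diag}(\lambda)\\\operatorname{diag}(\lambda)&0\end{bmatrix},\quad X(\lambda)=R_\phi^\top\Psi_\phi^\top M_\phi(\lambda)\Psi_\phi R_\phi.$$ $\mathscr X(t,x_0,A_d,B_d)$ denotes the solution at time $t$ of $x(t+1)=A_dx(t)+B_d\pi(x(t))$, $x(0)=x_0$, with (time-invariant) $A_d,B_d$. The uncertain system is locally stable around $x_*$ if, for every $A_d\in[\underline A_d,\overline A_d]$ and $B_d\in[\underline B_d,\overline B_d]$, the equilibrium $x_*$ of this system is stable in the sense of Lyapunov. *)

theory Defs
  imports Complex_Main "Jordan_Normal_Form.Matrix"
begin

section \<open>Definiteness, norms and interval matrices\<close>

definition pos_def :: "real mat \<Rightarrow> bool" where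
  "pos_def M \<longleftrightarrow> square_mat M \<and> transpose_mat M = M \<and>
     (\<forall>x \<in> carrier_vec (dim_row M). x \<noteq> 0\<^sub>v (dim_row M) \<longrightarrow> 0 < x \<bullet> (M *\<^sub>v x))"

definition pos_semidef :: "real mat \<Rightarrow> bool" where
  "pos_semidef M \<longleftrightarrow> square_mat M \<and> transpose_mat M = M \<and>
     (\<forall>x \<in> carrier_vec (dim_row M). 0 \<le> x \<bullet> (M *\<^sub>v x))"

definition neg_def :: "real mat \<Rightarrow> bool" where
  "neg_def M \<longleftrightarrow> pos_def (- M)"

definition vnorm :: "real Matrix.vec \<Rightarrow> real" where
  "vnorm x = sqrt (x \<bullet> x)"

definition vec_tendsto :: "(nat \<Rightarrow> real Matrix.vec) \<Rightarrow> real Matrix.vec \<Rightarrow> bool" where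
  "vec_tendsto X a \<longleftrightarrow> (\<lambda>t. vnorm (X t - a)) \<longlonglongrightarrow> 0"

text \<open>The interval matrix \<open>[L, U]\<close> is the order interval \<open>{L..U}\<close>, since \<open>\<le>\<close> on matrices
  means equal dimensions and entrywise inequality.\<close>

definition interval_vertices :: "real mat \<Rightarrow> real mat \<Rightarrow> real mat set" where
  "interval_vertices L U = {A \<in> carrier_mat (dim_row L) (dim_col L).
     \<forall>i < dim_row L. \<forall>j < dim_col L. A $$ (i,j) \<in> {L $$ (i,j), U $$ (i,j)}}"

definition diag_of :: "real Matrix.vec \<Rightarrow> real mat" where
  "diag_of v = mat_diag (dim_vec v) (\<lambda>i. v $ i)"

text \<open>Horizontal juxtaposition, the analogue of \<^const>\<open>append_rows\<close>.\<close>

definition append_cols :: "real mat \<Rightarrow> real mat \<Rightarrow> real mat" (infixr \<open>@\<^sub>c\<close> 65) where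
  "A @\<^sub>c B = four_block_mat A B (0\<^sub>m 0 (dim_col A)) (0\<^sub>m 0 (dim_col B))"


section \<open>Feedforward networks\<close>

text \<open>A network with \<open>l\<close> hidden layers is given by widths \<open>d 0, \<dots>, d l\<close>, weights
  \<open>W 1, \<dots>, W (l + 1)\<close>, biases \<open>b 1, \<dots>, b (l + 1)\<close> and a scalar activation \<open>\<phi>\<close>; values
  of these families at other indices are irrelevant.\<close>

definition network ::
  "nat \<Rightarrow> nat \<Rightarrow> nat \<Rightarrow> (nat \<Rightarrow> nat) \<Rightarrow> (nat \<Rightarrow> real mat) \<Rightarrow> (nat \<Rightarrow> real Matrix.vec) \<Rightarrow> bool" where
  "network n m l d W b \<longleftrightarrow> 1 \<le> l \<and> d 0 = n \<and>
     (\<forall>i \<in> {1..l}. W i \<in> carrier_mat (d i) (d (i - 1)) \<and> b i \<in> carrier_vec (d i)) \<and>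
     W (l + 1) \<in> carrier_mat m (d l) \<and> b (l + 1) \<in> carrier_vec m"

primrec layer_out ::
  "(nat \<Rightarrow> real mat) \<Rightarrow> (nat \<Rightarrow> real Matrix.vec) \<Rightarrow> (real \<Rightarrow> real) \<Rightarrow> nat \<Rightarrow> real Matrix.vec \<Rightarrow> real Matrix.vec"
where
  "layer_out W b \<phi> 0 x = x"
| "layer_out W b \<phi> (Suc i) x = map_vec \<phi> (W (Suc i) *\<^sub>v layer_out W b \<phi> i x + b (Suc i))"

definition layer_in ::
  "(nat \<Rightarrow> real mat) \<Rightarrow> (nat \<Rightarrow> real Matrix.vec) \<Rightarrow> (real \<Rightarrow> real) \<Rightarrow> nat \<Rightarrow> real Matrix.vec \<Rightarrow> real Matrix.vec"
where
  "layer_in W b \<phi> i x = W i *\<^sub>v layer_out W b \<phi> (i - 1) x + b i"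

definition nn ::
  "nat \<Rightarrow> (nat \<Rightarrow> real mat) \<Rightarrow> (nat \<Rightarrow> real Matrix.vec) \<Rightarrow> (real \<Rightarrow> real) \<Rightarrow> real Matrix.vec \<Rightarrow> real Matrix.vec"
where
  "nn l W b \<phi> x = W (l + 1) *\<^sub>v layer_out W b \<phi> l x + b (l + 1)"

definition nphi :: "(nat \<Rightarrow> nat) \<Rightarrow> nat \<Rightarrow> nat" where
  "nphi d l = (\<Sum>i = 1..l. d i)"

text \<open>\<open>stack z l\<close> is \<open>(z 1, \<dots>, z l)\<close>.\<close>

primrec stack :: "(nat \<Rightarrow> real Matrix.vec) \<Rightarrow> nat \<Rightarrow> real Matrix.vec" where
  "stack z 0 = 0\<^sub>v 0"
| "stack z (Suc i) = stack z i @\<^sub>v z (Suc i)"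

definition v_phi ::
  "nat \<Rightarrow> (nat \<Rightarrow> real mat) \<Rightarrow> (nat \<Rightarrow> real Matrix.vec) \<Rightarrow> (real \<Rightarrow> real) \<Rightarrow> real Matrix.vec \<Rightarrow> real Matrix.vec"
where
  "v_phi l W b \<phi> x = stack (\<lambda>i. layer_in W b \<phi> i x) l"

definition w_phi ::
  "nat \<Rightarrow> (nat \<Rightarrow> real mat) \<Rightarrow> (nat \<Rightarrow> real Matrix.vec) \<Rightarrow> (real \<Rightarrow> real) \<Rightarrow> real Matrix.vec \<Rightarrow> real Matrix.vec"
where
  "w_phi l W b \<phi> x = stack (\<lambda>i. layer_out W b \<phi> i x) l"


section \<open>The matrices of the network\<close>

definition N_vx :: "nat \<Rightarrow> nat \<Rightarrow> (nat \<Rightarrow> nat) \<Rightarrow> (nat \<Rightarrow> real mat) \<Rightarrow> real mat" where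
  "N_vx n l d W = W 1 @\<^sub>r 0\<^sub>m (nphi d l - d 1) n"

definition N_ux :: "nat \<Rightarrow> nat \<Rightarrow> real mat" where
  "N_ux n m = 0\<^sub>m m n"

definition N_uw :: "nat \<Rightarrow> nat \<Rightarrow> (nat \<Rightarrow> nat) \<Rightarrow> (nat \<Rightarrow> real mat) \<Rightarrow> real mat" where
  "N_uw m l d W = 0\<^sub>m m (nphi d (l - 1)) @\<^sub>c W (l + 1)"

text \<open>Passing from \<open>l\<close> to \<open>l + 1\<close> hidden layers adds a zero block column and the block row
  \<open>[0 \<dots> 0 W (l + 1) 0]\<close>, whose part left of the new diagonal block is the matrix \<open>N_uw\<close>
  of the first \<open>l\<close> hidden layers.\<close>

fun N_vw :: "nat \<Rightarrow> (nat \<Rightarrow> nat) \<Rightarrow> (nat \<Rightarrow> real mat) \<Rightarrow> real mat" where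
  "N_vw 0 d W = 0\<^sub>m 0 0"
| "N_vw (Suc 0) d W = 0\<^sub>m (d 1) (d 1)"
| "N_vw (Suc (Suc k)) d W =
     (let l = Suc k; r = d (Suc l) in
      four_block_mat (N_vw l d W)     (0\<^sub>m (nphi d l) r)
                     (N_uw r l d W)   (0\<^sub>m r r))"

lemma four_block_mult_vec:
  assumes "A \<in> carrier_mat r1 c1" "B \<in> carrier_mat r1 c2" "C \<in> carrier_mat r2 c1" "D \<in> carrier_mat r2 c2"
    and "x \<in> carrier_vec c1" "y \<in> carrier_vec c2"
  shows "four_block_mat A B C D *\<^sub>v (x @\<^sub>v y) = (A *\<^sub>v x + B *\<^sub>v y) @\<^sub>v (C *\<^sub>v x + D *\<^sub>v y)"
proof (rule eq_vecI)
  fix i assume i: "i < dim_vec ((A *\<^sub>v x + B *\<^sub>v y) @\<^sub>v (C *\<^sub>v x + D *\<^sub>v y))"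
  show "(four_block_mat A B C D *\<^sub>v (x @\<^sub>v y)) $ i = ((A *\<^sub>v x + B *\<^sub>v y) @\<^sub>v (C *\<^sub>v x + D *\<^sub>v y)) $ i"
  proof (cases "i < r1")
    case True
    then have "Matrix.row (four_block_mat A B C D) i = Matrix.row A i @\<^sub>v Matrix.row B i"
      using row_four_block_mat(1)[of A r1 c1 B c2 C r2 D i] assms by auto
    then show ?thesis using True i assms
      by (auto simp: scalar_prod_append[of _ c1 _ c2])
  next
    case False
    then have "Matrix.row (four_block_mat A B C D) i = Matrix.row C (i - r1) @\<^sub>v Matrix.row D (i - r1)"
      using row_four_block_mat(2)[of A r1 c1 B c2 C r2 D i] assms i by auto
    moreover have "Matrix.row C (i - r1) \<in> carrier_vec c1" "Matrix.row D (i - r1) \<in> carrier_vec c2"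
      using assms by auto
    ultimately show ?thesis using False i assms
      by (auto simp: scalar_prod_append[of _ c1 _ c2])
  qed
qed (use assms in auto)

lemma zero_mult_vec: "x \<in> carrier_vec c \<Longrightarrow> 0\<^sub>m r c *\<^sub>v x = (0\<^sub>v r :: real Matrix.vec)" by (intro eq_vecI) auto

lemma append_cols_mult_vec:
  assumes "A \<in> carrier_mat r c1" "B \<in> carrier_mat r c2" "x \<in> carrier_vec c1" "y \<in> carrier_vec c2"
  shows "(A @\<^sub>c B) *\<^sub>v (x @\<^sub>v y) = A *\<^sub>v x + B *\<^sub>v y"
  unfolding append_cols_def using assms
  by (subst four_block_mult_vec[of _ r c1 _ c2 _ 0]) (auto intro!: eq_vecI)

lemma stack_carrier: "(\<And>i. 1 \<le> i \<Longrightarrow> i \<le> l \<Longrightarrow> z i \<in> carrier_vec (d i)) \<Longrightarrow> stack z l \<in> carrier_vec (nphi d l)"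
  by (induction l) (auto simp: nphi_def intro!: append_carrier_vec)

lemma v_phi_affine_aux:
  assumes W: "\<And>i. 1 \<le> i \<Longrightarrow> i \<le> Suc k \<Longrightarrow> W i \<in> carrier_mat (d i) (d (i - 1)) \<and> b i \<in> carrier_vec (d i)"
    and x: "x \<in> carrier_vec (d 0)"
  shows "v_phi (Suc k) W b \<phi> x = N_vx (d 0) (Suc k) d W *\<^sub>v x + N_vw (Suc k) d W *\<^sub>v w_phi (Suc k) W b \<phi> x + stack b (Suc k)
    \<and> N_vw (Suc k) d W \<in> carrier_mat (nphi d (Suc k)) (nphi d (Suc k))"
  using W
proof (induction k)
  case 0
  have "W 1 \<in> carrier_mat (d 1) (d 0)" "b 1 \<in> carrier_vec (d 1)" using 0[of 1] by auto
  moreover have "N_vx (d 0) 1 d W *\<^sub>v x = (W 1 *\<^sub>v x) @\<^sub>v 0\<^sub>v 0"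
    unfolding N_vx_def using calculation x
    by (subst mat_mult_append[of _ "d 1" "d 0" _ 0]) (auto simp: nphi_def zero_mult_vec)
  ultimately show ?case using x
    by (auto simp: v_phi_def w_phi_def layer_in_def nphi_def intro!: eq_vecI)
next
  case (Suc k)
  define l where "l = Suc k"
  have Wi: "W i \<in> carrier_mat (d i) (d (i - 1))" "b i \<in> carrier_vec (d i)" if "1 \<le> i" "i \<le> Suc l" for i
    using Suc.prems[of i] that unfolding l_def by blast+
  have lo: "layer_out W b \<phi> i x \<in> carrier_vec (d i)" if "i \<le> Suc l" for i
    using that
  proof (induction i)
    case 0
    then show ?case using x by simp
  next
    case (Suc i)
    then have "b (Suc i) \<in> carrier_vec (d (Suc i))" using Wi(2)[of "Suc i"] by simp
    then show ?case by (intro carrier_vecI) simp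
  qed
  have W1: "W 1 \<in> carrier_mat (d 1) (d 0)" using Suc.prems[of 1] by auto
  have Wl: "W (Suc l) \<in> carrier_mat (d (Suc l)) (d l)" "b (Suc l) \<in> carrier_vec (d (Suc l))" using Suc.prems[of "Suc l"] by (auto simp: l_def)
  have IH: "v_phi l W b \<phi> x = N_vx (d 0) l d W *\<^sub>v x + N_vw l d W *\<^sub>v w_phi l W b \<phi> x + stack b l"
    and Nc: "N_vw l d W \<in> carrier_mat (nphi d l) (nphi d l)"
    using Suc.IH Suc.prems by (auto simp: l_def)
  have n1: "nphi d l = nphi d (l - 1) + d l" "nphi d (Suc l) = nphi d l + d (Suc l)" by (auto simp: nphi_def l_def)
  have d1: "d 1 \<le> nphi d l" unfolding nphi_def l_def by (rule member_le_sum) auto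
  have wc: "w_phi i W b \<phi> x \<in> carrier_vec (nphi d i)" if "i \<le> Suc l" for i
    unfolding w_phi_def using that lo by (intro stack_carrier) auto
  have w: "w_phi (Suc l) W b \<phi> x = w_phi l W b \<phi> x @\<^sub>v layer_out W b \<phi> (Suc l) x" by (simp add: w_phi_def)
  have w2: "w_phi l W b \<phi> x = w_phi (l - 1) W b \<phi> x @\<^sub>v layer_out W b \<phi> l x" by (simp add: w_phi_def l_def)
  have v: "v_phi (Suc l) W b \<phi> x = v_phi l W b \<phi> x @\<^sub>v (W (Suc l) *\<^sub>v layer_out W b \<phi> l x + b (Suc l))"
    by (simp add: v_phi_def layer_in_def)
  have bc: "stack b l \<in> carrier_vec (nphi d l)" using Suc.prems by (intro stack_carrier) (auto simp: l_def)
  have uwc: "N_uw (d (Suc l)) l d W \<in> carrier_mat (d (Suc l)) (nphi d l)"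
    unfolding N_uw_def append_cols_def using Wl n1 by auto
  have uw: "N_uw (d (Suc l)) l d W *\<^sub>v w_phi l W b \<phi> x = W (Suc l) *\<^sub>v layer_out W b \<phi> l x"
    unfolding N_uw_def w2 using Wl lo[of l] wc[of "l - 1"] n1
    by (subst append_cols_mult_vec[of _ "d (Suc l)" "nphi d (l-1)" _ "d l"]) (auto simp: zero_mult_vec)
  have Nvw: "N_vw (Suc l) d W = four_block_mat (N_vw l d W) (0\<^sub>m (nphi d l) (d (Suc l))) (N_uw (d (Suc l)) l d W) (0\<^sub>m (d (Suc l)) (d (Suc l)))"
    by (simp add: l_def Let_def)
  have t1: "N_vw (Suc l) d W *\<^sub>v w_phi (Suc l) W b \<phi> x = (N_vw l d W *\<^sub>v w_phi l W b \<phi> x) @\<^sub>v (W (Suc l) *\<^sub>v layer_out W b \<phi> l x)"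
    unfolding Nvw w using Nc uwc wc[of l] lo[of "Suc l"] Wl
    by (subst four_block_mult_vec[of _ "nphi d l" "nphi d l" _ "d (Suc l)" _ "d (Suc l)"]) (auto simp: zero_mult_vec uw)
  have vx: "N_vx (d 0) j d W *\<^sub>v x = (W 1 *\<^sub>v x) @\<^sub>v 0\<^sub>v (nphi d j - d 1)" for j
    unfolding N_vx_def using W1 x by (subst mat_mult_append[of _ "d 1" "d 0" _ "nphi d j - d 1"]) (auto simp: zero_mult_vec)
  have q: "nphi d (Suc l) - d 1 = (nphi d l - d 1) + d (Suc l)" using n1(2) d1 by linarith
  have t2: "N_vx (d 0) (Suc l) d W *\<^sub>v x = (N_vx (d 0) l d W *\<^sub>v x) @\<^sub>v 0\<^sub>v (d (Suc l))"
    unfolding vx[of "Suc l"] vx[of l] q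
  proof (rule eq_vecI)
    fix i
    assume "i < dim_vec ((W 1 *\<^sub>v x @\<^sub>v 0\<^sub>v (nphi d l - d 1)) @\<^sub>v 0\<^sub>v (d (Suc l)))"
    then show "(W 1 *\<^sub>v x @\<^sub>v 0\<^sub>v (nphi d l - d 1 + d (Suc l))) $ i =
        ((W 1 *\<^sub>v x @\<^sub>v 0\<^sub>v (nphi d l - d 1)) @\<^sub>v 0\<^sub>v (d (Suc l))) $ i"
      by (cases "i < dim_row (W 1)"; cases "i < dim_row (W 1) + (nphi d l - d 1)") simp_all
  qed simp
  have "(W 1 *\<^sub>v x) @\<^sub>v 0\<^sub>v (nphi d l - d 1) \<in> carrier_vec (d 1 + (nphi d l - d 1))"
    using W1 x by (intro append_carrier_vec) simp_all
  then have vxc: "N_vx (d 0) l d W *\<^sub>v x \<in> carrier_vec (nphi d l)"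
    using d1 by (simp only: vx le_add_diff_inverse)
  have nwc: "N_vw l d W *\<^sub>v w_phi l W b \<phi> x \<in> carrier_vec (nphi d l)"
    using Nc wc[of l] by simp
  have yc: "W (Suc l) *\<^sub>v layer_out W b \<phi> l x \<in> carrier_vec (d (Suc l))"
    using Wl(1) lo[of l] by simp
  have "N_vx (d 0) (Suc l) d W *\<^sub>v x + N_vw (Suc l) d W *\<^sub>v w_phi (Suc l) W b \<phi> x + stack b (Suc l) =
    (N_vx (d 0) l d W *\<^sub>v x + N_vw l d W *\<^sub>v w_phi l W b \<phi> x + stack b l) @\<^sub>v
    (0\<^sub>v (d (Suc l)) + W (Suc l) *\<^sub>v layer_out W b \<phi> l x + b (Suc l))"
    unfolding t1 t2 stack.simps
    by (simp only: append_vec_add[OF vxc nwc zero_carrier_vec yc]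
        append_vec_add[OF add_carrier_vec[OF vxc nwc] bc add_carrier_vec[OF zero_carrier_vec yc] Wl(2)])
  then have "v_phi (Suc l) W b \<phi> x = N_vx (d 0) (Suc l) d W *\<^sub>v x + N_vw (Suc l) d W *\<^sub>v w_phi (Suc l) W b \<phi> x + stack b (Suc l)"
    unfolding v IH by (simp only: left_zero_vec[OF yc])
  moreover have "N_vw (Suc l) d W \<in> carrier_mat (nphi d (Suc l)) (nphi d (Suc l))"
    unfolding Nvw using Nc uwc n1 by auto
  ultimately show ?case by (simp add: l_def)
qed

text \<open>The affine identities that the \<open>N\<close> matrices stand for.\<close>

lemma network_affine:
  assumes "network n m l d W b" "x \<in> carrier_vec n"
  shows "nn l W b \<phi> x = N_ux n m *\<^sub>v x + N_uw m l d W *\<^sub>v w_phi l W b \<phi> x + b (l + 1)"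
    and "v_phi l W b \<phi> x = N_vx n l d W *\<^sub>v x + N_vw l d W *\<^sub>v w_phi l W b \<phi> x + stack b l"
proof -
  obtain k where l: "l = Suc k" using assms by (cases l) (auto simp: network_def)
  have W: "\<And>i. 1 \<le> i \<Longrightarrow> i \<le> l \<Longrightarrow> W i \<in> carrier_mat (d i) (d (i - 1)) \<and> b i \<in> carrier_vec (d i)"
    and Wl: "W (l + 1) \<in> carrier_mat m (d l)" "b (l + 1) \<in> carrier_vec m" and d0: "d 0 = n"
    using assms by (auto simp: network_def)
  have "v_phi (Suc k) W b \<phi> x =
      N_vx (d 0) (Suc k) d W *\<^sub>v x + N_vw (Suc k) d W *\<^sub>v w_phi (Suc k) W b \<phi> x + stack b (Suc k)"
    using v_phi_affine_aux[of k W d b x \<phi>] W assms(2) unfolding l d0 by blast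
  then show "v_phi l W b \<phi> x = N_vx n l d W *\<^sub>v x + N_vw l d W *\<^sub>v w_phi l W b \<phi> x + stack b l"
    unfolding l d0 .
  have lo: "layer_out W b \<phi> i x \<in> carrier_vec (d i)" if "i \<le> l" for i
    using that
  proof (induction i)
    case 0
    then show ?case using assms(2) d0 by simp
  next
    case (Suc i)
    then have "b (Suc i) \<in> carrier_vec (d (Suc i))" using W[of "Suc i"] by simp
    then show ?case by (intro carrier_vecI) simp
  qed
  have wc: "w_phi i W b \<phi> x \<in> carrier_vec (nphi d i)" if "i \<le> l" for i
    unfolding w_phi_def using that lo by (intro stack_carrier) auto
  have w2: "w_phi l W b \<phi> x = w_phi k W b \<phi> x @\<^sub>v layer_out W b \<phi> l x" by (simp add: w_phi_def l)
  have "N_uw m l d W *\<^sub>v w_phi l W b \<phi> x = W (l + 1) *\<^sub>v layer_out W b \<phi> l x"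
    unfolding N_uw_def w2 using Wl lo[of l] wc[of k] l
    by (subst append_cols_mult_vec[of _ m "nphi d k" _ "d l"]) (auto simp: zero_mult_vec)
  then show "nn l W b \<phi> x = N_ux n m *\<^sub>v x + N_uw m l d W *\<^sub>v w_phi l W b \<phi> x + b (l + 1)"
    using Wl assms(2) lo[of l] by (simp add: nn_def N_ux_def zero_mult_vec)
qed

definition R_V :: "nat \<Rightarrow> nat \<Rightarrow> nat \<Rightarrow> (nat \<Rightarrow> nat) \<Rightarrow> (nat \<Rightarrow> real mat) \<Rightarrow> real mat" where
  "R_V n m l d W = four_block_mat (1\<^sub>m n)     (0\<^sub>m n (nphi d l))
                                  (N_ux n m)  (N_uw m l d W)"

definition R_phi :: "nat \<Rightarrow> nat \<Rightarrow> (nat \<Rightarrow> nat) \<Rightarrow> (nat \<Rightarrow> real mat) \<Rightarrow> real mat" where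
  "R_phi n l d W = four_block_mat (N_vx n l d W)       (N_vw l d W)
                                  (0\<^sub>m (nphi d l) n)    (1\<^sub>m (nphi d l))"

definition Psi_phi :: "nat \<Rightarrow> real Matrix.vec \<Rightarrow> real Matrix.vec \<Rightarrow> real mat" where
  "Psi_phi k \<alpha> \<beta> = four_block_mat (diag_of \<beta>)      (- 1\<^sub>m k)
                                  (- diag_of \<alpha>)    (1\<^sub>m k)"

definition M_phi :: "nat \<Rightarrow> real Matrix.vec \<Rightarrow> real mat" where
  "M_phi k lam = four_block_mat (0\<^sub>m k k)       (diag_of lam)
                                (diag_of lam)   (0\<^sub>m k k)"

definition X_mat ::
  "nat \<Rightarrow> nat \<Rightarrow> (nat \<Rightarrow> nat) \<Rightarrow> (nat \<Rightarrow> real mat) \<Rightarrow> real Matrix.vec \<Rightarrow> real Matrix.vec \<Rightarrow> real Matrix.vec \<Rightarrow> real mat"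
where
  "X_mat n l d W \<alpha> \<beta> lam =
     (let R = R_phi n l d W; Psi = Psi_phi (nphi d l) \<alpha> \<beta>
      in transpose_mat R * transpose_mat Psi * M_phi (nphi d l) lam * Psi * R)"

definition bound_lmi ::
  "(nat \<Rightarrow> real mat) \<Rightarrow> real Matrix.vec \<Rightarrow> real Matrix.vec \<Rightarrow> real mat \<Rightarrow> nat \<Rightarrow> real mat"
where
  "bound_lmi W vhi1 vs1 P i =
     (let r = mat_of_row (Matrix.row (W 1) i)
      in four_block_mat (Matrix.mat 1 1 (\<lambda>_. (vhi1 $ i - vs1 $ i)\<^sup>2))  r
                        (transpose_mat r)                             P)"

definition stability_lmi ::
  "nat \<Rightarrow> nat \<Rightarrow> nat \<Rightarrow> (nat \<Rightarrow> nat) \<Rightarrow> (nat \<Rightarrow> real mat) \<Rightarrow> real Matrix.vec \<Rightarrow> real Matrix.vec \<Rightarrow>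
   real Matrix.vec \<Rightarrow> real mat \<Rightarrow> real mat \<Rightarrow> real mat \<Rightarrow> real mat"
where
  "stability_lmi n m l d W \<alpha> \<beta> lam P A B =
     (let R = R_V n m l d W;
          T = - (transpose_mat R * (1\<^sub>m n @\<^sub>r 0\<^sub>m m n) * P * (1\<^sub>m n @\<^sub>c 0\<^sub>m n m) * R)
                + X_mat n l d W \<alpha> \<beta> lam;
          S = P * (A @\<^sub>c B) * R
      in four_block_mat T   (transpose_mat S)
                        S   (- P))"


section \<open>Local sector bounds\<close>

definition sector_bounded ::
  "(real \<Rightarrow> real) \<Rightarrow> real \<Rightarrow> real \<Rightarrow> real \<Rightarrow> real \<Rightarrow> real \<Rightarrow> bool" where
  "sector_bounded \<phi> \<alpha> \<beta> vs lo hi \<longleftrightarrow> vs \<in> {lo..hi} \<and>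
     (\<forall>v \<in> {lo..hi}. (\<phi> v - \<phi> vs - \<alpha> * (v - vs)) * (\<phi> v - \<phi> vs - \<beta> * (v - vs)) \<le> 0)"


section \<open>Closed loop, stability, region of attraction\<close>

definition closed_loop ::
  "(real Matrix.vec \<Rightarrow> real Matrix.vec) \<Rightarrow> real mat \<Rightarrow> real mat \<Rightarrow> real Matrix.vec \<Rightarrow> real Matrix.vec" where
  "closed_loop \<pi> A B x = A *\<^sub>v x + B *\<^sub>v \<pi> x"

primrec solution ::
  "(real Matrix.vec \<Rightarrow> real Matrix.vec) \<Rightarrow> real mat \<Rightarrow> real mat \<Rightarrow> real Matrix.vec \<Rightarrow> nat \<Rightarrow> real Matrix.vec"
where
  "solution \<pi> A B x0 0 = x0"
| "solution \<pi> A B x0 (Suc t) = closed_loop \<pi> A B (solution \<pi> A B x0 t)"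

definition lyapunov_stable ::
  "nat \<Rightarrow> (real Matrix.vec \<Rightarrow> real Matrix.vec) \<Rightarrow> real mat \<Rightarrow> real mat \<Rightarrow> real Matrix.vec \<Rightarrow> bool" where
  "lyapunov_stable n \<pi> A B xs \<longleftrightarrow> closed_loop \<pi> A B xs = xs \<and>
     (\<forall>\<epsilon> > 0. \<exists>\<delta> > 0. \<forall>x0 \<in> carrier_vec n. vnorm (x0 - xs) < \<delta> \<longrightarrow>
        (\<forall>t. vnorm (solution \<pi> A B x0 t - xs) < \<epsilon>))"

definition locally_stable ::
  "nat \<Rightarrow> (real Matrix.vec \<Rightarrow> real Matrix.vec) \<Rightarrow> real mat \<Rightarrow> real mat \<Rightarrow> real mat \<Rightarrow> real mat \<Rightarrow>
   real Matrix.vec \<Rightarrow> bool"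
where
  "locally_stable n \<pi> Alo Ahi Blo Bhi xs \<longleftrightarrow>
     (\<forall>A \<in> {Alo..Ahi}. \<forall>B \<in> {Blo..Bhi}. lyapunov_stable n \<pi> A B xs)"

definition robust_roa ::
  "nat \<Rightarrow> (real Matrix.vec \<Rightarrow> real Matrix.vec) \<Rightarrow> real mat \<Rightarrow> real mat \<Rightarrow> real mat \<Rightarrow> real mat \<Rightarrow>
   real Matrix.vec \<Rightarrow> real Matrix.vec set"
where
  "robust_roa n \<pi> Alo Ahi Blo Bhi xs = {x \<in> carrier_vec n.
     \<forall>A \<in> {Alo..Ahi}. \<forall>B \<in> {Blo..Bhi}. vec_tendsto (solution \<pi> A B x) xs}"

definition ellipsoid :: "nat \<Rightarrow> real mat \<Rightarrow> real Matrix.vec \<Rightarrow> real Matrix.vec set" where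
  "ellipsoid n P xs = {x \<in> carrier_vec n. (x - xs) \<bullet> (P *\<^sub>v (x - xs)) \<le> 1}"

end

theory Submission
  imports Defs "HOL-Analysis.Function_Topology"
begin

text \<open>The quadratic form \<open>V x = x \<bullet> P x\<close> is a common Lyapunov function of all the closed loops. Let
  \<open>x\<close> lie in the ellipsoid \<open>V x \<le> 1\<close>, and let \<open>\<Delta>v\<close>, \<open>\<Delta>w\<close> be the deviations of the activation
  inputs and outputs from their equilibrium values. The first matrix inequality is the Schur
  complement form of the statement that the ellipsoid lies in the slab of inputs whose first-layer
  activation inputs stay in the prescribed box (\<open>bound_lmi_imp_abs_le\<close>); hence all activation
  inputs stay in their boxes, the sector bounds apply, and the weighted sum of the products
  \<open>(\<beta>\<^sub>i \<Delta>v\<^sub>i - \<Delta>w\<^sub>i) (\<Delta>w\<^sub>i - \<alpha>\<^sub>i \<Delta>v\<^sub>i)\<close> is nonnegative (\<open>sector_sum_nonneg\<close>).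

  On a vector \<open>(x, w, y)\<close> the stability matrix has the quadratic form
  \<open>- V x + 2 (\<dots>) + 2 y \<bullet> P (A x + B u) - V y\<close>, where \<open>(\<dots>)\<close> is the weighted sector sum and \<open>u\<close>
  the network output that belongs to \<open>w\<close> (\<open>stability_lmi_quadratic_form\<close>). For fixed
  \<open>(x, w, y)\<close> this is affine in the entries of \<open>A\<close> and \<open>B\<close>, so its maximum over the
  interval matrices is attained at vertices, and negativity at the vertices gives negativity on the
  whole interval (\<open>stability_lmi_vertices_imp_interval\<close>). Choosing \<open>w = \<Delta>w\<close> and
  \<open>y = A x + B \<pi>(x)\<close>, the successor state, turns the last two terms into \<open>V y\<close>, and the
  nonnegative sector sum can be dropped: \<open>V y < V x\<close> for \<open>x \<noteq> 0\<close>.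

  The activation function may be discontinuous, and then strict decrease alone does not give
  convergence. But a definite form in finitely many variables is coercive
  (\<open>pos_form_coercive\<close>), which improves the decrease to
  \<open>V y \<le> V x - \<mu> (x \<bullet> x)\<close> with \<open>\<mu> > 0\<close>. This yields a geometric decay of \<open>V\<close> along every
  solution that starts in the ellipsoid, and with it both stability and attraction
  (\<open>lyapunov_decrease_imp_stable_and_attracting\<close>).\<close>

section \<open>Quadratic forms\<close>

lemma scalar_prod_mat_vec_sum:
  assumes "M \<in> carrier_mat r c" "p \<in> carrier_vec r" "x \<in> carrier_vec c"
  shows "p \<bullet> (M *\<^sub>v x) = (\<Sum>i<r. \<Sum>j<c. (p $ i * x $ j) * (M $$ (i,j) :: real))"
proof -
  have "p \<bullet> (M *\<^sub>v x) = (\<Sum>i<r. p $ i * (\<Sum>j<c. M $$ (i,j) * x $ j))"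
    using assms by (auto simp: scalar_prod_def lessThan_atLeast0 intro!: sum.cong)
  also have "\<dots> = (\<Sum>i<r. \<Sum>j<c. (p $ i * x $ j) * M $$ (i,j))"
    by (simp add: sum_distrib_left mult_ac)
  finally show ?thesis .
qed

lemma scalar_prod_self: "(x::real Matrix.vec) \<in> carrier_vec k \<Longrightarrow> x \<bullet> x = (\<Sum>i<k. (x $ i)\<^sup>2)"
  by (auto simp: scalar_prod_def lessThan_atLeast0 power2_eq_square)

lemma scalar_prod_self_nonneg: "0 \<le> (x::real Matrix.vec) \<bullet> x"
  by (auto simp: scalar_prod_def intro!: sum_nonneg)

text \<open>Coefficient vectors are represented as functions on the natural numbers that vanish from \<open>k\<close> on.
  In the product topology the sphere is then a closed subset of a compact box, so the form attains
  its minimum there; homogeneity of degree two carries the bound from the sphere to all vectors.\<close>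

lemma quadratic_form_min_on_sphere:
  fixes M :: "real mat"
  assumes M: "M \<in> carrier_mat k k" and k: "0 < k"
  obtains u where "u \<in> carrier_vec k" "u \<bullet> u = 1"
    "\<And>x. x \<in> carrier_vec k \<Longrightarrow> (u \<bullet> (M *\<^sub>v u)) * (x \<bullet> x) \<le> x \<bullet> (M *\<^sub>v x)"
proof -
  define q where "q f = (\<Sum>i<k. \<Sum>j<k. (f i * f j) * M $$ (i,j))" for f :: "nat \<Rightarrow> real"
  define box where "box = (PiE UNIV (\<lambda>i. if i < k then {-1..1} else {0}) :: (nat \<Rightarrow> real) set)"
  define K where "K = box \<inter> {f. (\<Sum>i<k. (f i)\<^sup>2) = 1}"
  have q: "q (($) x) = x \<bullet> (M *\<^sub>v x)" if "x \<in> carrier_vec k" for x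
    using scalar_prod_mat_vec_sum[OF M that that] by (simp add: q_def)
  have "compact box"
    unfolding box_def compactin_euclidean_iff[symmetric] euclidean_product_topology[symmetric]
    by (subst compactin_PiE) (auto)
  moreover have "closed {f :: nat \<Rightarrow> real. (\<Sum>i<k. (f i)\<^sup>2) = 1}"
    by (intro closed_Collect_eq continuous_intros continuous_on_product_coordinates)
  ultimately have "compact K" unfolding K_def by (rule compact_Int_closed)
  moreover have "(\<lambda>i. if i = 0 then 1 else 0) \<in> K"
  proof -
    have "(\<Sum>i<k. (if i = 0 then 1 else 0 :: real)\<^sup>2) = (\<Sum>i<k. if i = 0 then 1 else 0)"
      by (intro sum.cong) auto
    then show ?thesis using k by (auto simp: K_def box_def)
  qed
  moreover have "continuous_on K q"
    unfolding q_def
    by (intro continuous_intros continuous_on_subset[OF continuous_on_product_coordinates subset_UNIV])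
  ultimately obtain f where f: "f \<in> K" and min: "\<And>g. g \<in> K \<Longrightarrow> q f \<le> q g"
    using continuous_attains_inf[of K q] by blast
  define u where "u = Matrix.vec k f"
  have u: "u \<in> carrier_vec k" by (simp add: u_def)
  have qu: "u \<bullet> (M *\<^sub>v u) = q f"
    unfolding q[OF u, symmetric] by (simp add: q_def u_def)
  show thesis
  proof
    show "u \<bullet> u = 1" using f by (simp add: scalar_prod_self[OF u]) (simp add: u_def K_def)
  next
    fix x :: "real Matrix.vec" assume x: "x \<in> carrier_vec k"
    show "(u \<bullet> (M *\<^sub>v u)) * (x \<bullet> x) \<le> x \<bullet> (M *\<^sub>v x)"
    proof (cases "x \<bullet> x = 0")
      case True
      then have "x $ i = 0" if "i < k" for i
        using that unfolding scalar_prod_self[OF x] by (subst (asm) sum_nonneg_eq_0_iff) auto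
      then have "x \<bullet> (M *\<^sub>v x) = 0" by (simp add: q[OF x, symmetric] q_def)
      with True show ?thesis by simp
    next
      case False
      define r where "r = sqrt (x \<bullet> x)"
      have r: "0 < r" "r\<^sup>2 = x \<bullet> x"
        using False scalar_prod_self_nonneg[of x] by (auto simp: r_def)
      define g where "g i = (if i < k then x $ i / r else 0)" for i
      have sq: "(\<Sum>i<k. (g i)\<^sup>2) = 1"
      proof -
        have "(\<Sum>i<k. (g i)\<^sup>2) = (\<Sum>i<k. (x $ i)\<^sup>2) / r\<^sup>2"
          by (simp add: g_def power_divide sum_divide_distrib)
        then show ?thesis using r False scalar_prod_self[OF x] by simp
      qed
      have "g i \<in> (if i < k then {-1..1} else {0})" for i
      proof (cases "i < k")
        case True
        have "(g i)\<^sup>2 \<le> (\<Sum>i<k. (g i)\<^sup>2)" using True by (intro member_le_sum) auto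
        then have "\<bar>g i\<bar> \<le> 1" by (simp add: sq abs_square_le_1)
        then show ?thesis by (auto simp: True abs_le_iff)
      qed (simp add: g_def)
      then have "g \<in> K" using sq by (simp add: K_def box_def PiE_iff)
      then have "q f * r\<^sup>2 \<le> q g * r\<^sup>2" by (intro mult_right_mono min) auto
      also have "q g * r\<^sup>2 = q (($) x)"
        using r(1) by (simp add: q_def g_def sum_distrib_right power2_eq_square)
      finally show ?thesis by (simp add: qu q[OF x] r(2))
    qed
  qed (fact u)
qed

text \<open>The minimum over the unit sphere is attained at a nonzero vector, hence positive. In dimension zero
  the sphere is empty and any constant will do.\<close>

lemma pos_form_coercive:
  fixes M :: "real mat"
  assumes M: "M \<in> carrier_mat k k"
    and pos: "\<And>x. x \<in> carrier_vec k \<Longrightarrow> x \<noteq> 0\<^sub>v k \<Longrightarrow> 0 < x \<bullet> (M *\<^sub>v x)"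
  obtains c where "0 < c" "\<And>x. x \<in> carrier_vec k \<Longrightarrow> c * (x \<bullet> x) \<le> x \<bullet> (M *\<^sub>v x)"
proof (cases "k = 0")
  case True
  have "1 * (x \<bullet> x) \<le> x \<bullet> (M *\<^sub>v x)" if "x \<in> carrier_vec k" for x
    using that M True by (simp add: scalar_prod_def)
  then show thesis using that[of 1] by simp
next
  case False
  then obtain u where u: "u \<in> carrier_vec k" "u \<bullet> u = 1"
    "\<And>x. x \<in> carrier_vec k \<Longrightarrow> (u \<bullet> (M *\<^sub>v u)) * (x \<bullet> x) \<le> x \<bullet> (M *\<^sub>v x)"
    using quadratic_form_min_on_sphere[OF M] by blast
  have "u \<noteq> 0\<^sub>v k" using u(2) by auto
  then show thesis using that[OF pos[OF u(1)]] u(3) by blast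
qed

lemma scalar_prod_uminus_mat:
  fixes M :: "real mat"
  assumes "M \<in> carrier_mat r c" "p \<in> carrier_vec r" "x \<in> carrier_vec c"
  shows "p \<bullet> (- M *\<^sub>v x) = - (p \<bullet> (M *\<^sub>v x))"
  using assms by simp

lemma quadratic_form_bounded:
  fixes M :: "real mat"
  assumes M: "M \<in> carrier_mat k k"
  obtains C where "0 < C" "\<And>x. x \<in> carrier_vec k \<Longrightarrow> x \<bullet> (M *\<^sub>v x) \<le> C * (x \<bullet> x)"
proof (cases "k = 0")
  case True
  have "x \<bullet> (M *\<^sub>v x) \<le> 1 * (x \<bullet> x)" if "x \<in> carrier_vec k" for x
    using that M True by (simp add: scalar_prod_def)
  then show thesis using that[of 1] by simp
next
  case False
  have "- M \<in> carrier_mat k k" using M by simp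
  then obtain u where u: "\<And>x. x \<in> carrier_vec k \<Longrightarrow> (u \<bullet> (- M *\<^sub>v u)) * (x \<bullet> x) \<le> x \<bullet> (- M *\<^sub>v x)"
    using quadratic_form_min_on_sphere[of "- M" k] False by blast
  define C where "C = max 1 (- (u \<bullet> (- M *\<^sub>v u)))"
  have "x \<bullet> (M *\<^sub>v x) \<le> C * (x \<bullet> x)" if x: "x \<in> carrier_vec k" for x
  proof -
    have "x \<bullet> (M *\<^sub>v x) \<le> - (u \<bullet> (- M *\<^sub>v u)) * (x \<bullet> x)"
      using u[OF x] by (simp add: scalar_prod_uminus_mat[OF M x x])
    also have "\<dots> \<le> C * (x \<bullet> x)"
      by (intro mult_right_mono scalar_prod_self_nonneg) (simp add: C_def)
    finally show ?thesis .
  qed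
  then show thesis using that[of C] by (simp add: C_def)
qed

text \<open>The value of a symmetric block form: the two off-diagonal blocks contribute equally.\<close>

lemma quadratic_form_four_block:
  fixes A S D :: "real mat"
  assumes A: "A \<in> carrier_mat p p" and S: "S \<in> carrier_mat r p" and D: "D \<in> carrier_mat r r"
    and x: "x \<in> carrier_vec p" and y: "y \<in> carrier_vec r"
  shows "(x @\<^sub>v y) \<bullet> (four_block_mat A (transpose_mat S) S D *\<^sub>v (x @\<^sub>v y)) =
    x \<bullet> (A *\<^sub>v x) + 2 * (y \<bullet> (S *\<^sub>v x)) + y \<bullet> (D *\<^sub>v y)"
proof -
  have c: "A *\<^sub>v x \<in> carrier_vec p" "transpose_mat S *\<^sub>v y \<in> carrier_vec p"
    "S *\<^sub>v x \<in> carrier_vec r" "D *\<^sub>v y \<in> carrier_vec r"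
    using assms by (auto intro!: mult_mat_vec_carrier)
  have "four_block_mat A (transpose_mat S) S D *\<^sub>v (x @\<^sub>v y) =
      (A *\<^sub>v x + transpose_mat S *\<^sub>v y) @\<^sub>v (S *\<^sub>v x + D *\<^sub>v y)"
    by (rule four_block_mult_vec[of _ p p _ r _ r]) (use assms in auto)
  then have "(x @\<^sub>v y) \<bullet> (four_block_mat A (transpose_mat S) S D *\<^sub>v (x @\<^sub>v y)) =
      x \<bullet> (A *\<^sub>v x) + x \<bullet> (transpose_mat S *\<^sub>v y) + (y \<bullet> (S *\<^sub>v x) + y \<bullet> (D *\<^sub>v y))"
    by (simp only: scalar_prod_append[OF x y add_carrier_vec[OF c(1,2)] add_carrier_vec[OF c(3,4)]]
        scalar_prod_add_distrib[OF x c(1,2)] scalar_prod_add_distrib[OF y c(3,4)])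
  moreover have "x \<bullet> (transpose_mat S *\<^sub>v y) = y \<bullet> (S *\<^sub>v x)"
    using transpose_vec_mult_scalar[OF S x y] comm_scalar_prod[OF x c(2)] by simp
  ultimately show ?thesis by simp
qed

lemma congruence_carrier:
  fixes R M :: "real mat"
  assumes "R \<in> carrier_mat r c" "M \<in> carrier_mat r r"
  shows "transpose_mat R * M * R \<in> carrier_mat c c"
  using assms by (intro mult_carrier_mat[of _ c r]) auto

lemma congruence_quadratic_form:
  fixes R M :: "real mat"
  assumes R: "R \<in> carrier_mat r c" and M: "M \<in> carrier_mat r r" and z: "z \<in> carrier_vec c"
  shows "z \<bullet> ((transpose_mat R * M * R) *\<^sub>v z) = (R *\<^sub>v z) \<bullet> (M *\<^sub>v (R *\<^sub>v z))"
proof -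
  have Rz: "R *\<^sub>v z \<in> carrier_vec r" and MRz: "M *\<^sub>v (R *\<^sub>v z) \<in> carrier_vec r"
    using R M z by auto
  have "(transpose_mat R * M * R) *\<^sub>v z = (transpose_mat R * M) *\<^sub>v (R *\<^sub>v z)"
    using R M z by (intro assoc_mult_mat_vec[of _ c r]) auto
  also have "\<dots> = transpose_mat R *\<^sub>v (M *\<^sub>v (R *\<^sub>v z))"
    using R M Rz by (intro assoc_mult_mat_vec[of _ c r]) auto
  finally have "z \<bullet> ((transpose_mat R * M * R) *\<^sub>v z) = z \<bullet> (transpose_mat R *\<^sub>v (M *\<^sub>v (R *\<^sub>v z)))"
    by simp
  also have "\<dots> = (transpose_mat R *\<^sub>v (M *\<^sub>v (R *\<^sub>v z))) \<bullet> z"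
    using R MRz z by (intro comm_scalar_prod[of _ c]) (auto intro!: mult_mat_vec_carrier)
  also have "\<dots> = (M *\<^sub>v (R *\<^sub>v z)) \<bullet> (R *\<^sub>v z)"
    by (rule transpose_vec_mult_scalar[OF R z MRz])
  also have "\<dots> = (R *\<^sub>v z) \<bullet> (M *\<^sub>v (R *\<^sub>v z))"
    by (rule comm_scalar_prod[OF MRz Rz])
  finally show ?thesis .
qed

section \<open>Quadratic Lyapunov functions\<close>

lemma vnorm_nonneg: "0 \<le> vnorm x"
  by (simp add: vnorm_def scalar_prod_self_nonneg)

text \<open>Since \<open>V\<close> is comparable to the squared norm from both sides, the decrease by a multiple of
  \<open>x \<bullet> x\<close> is a contraction \<open>V (x(t+1)) \<le> q V (x(t))\<close> with \<open>q < 1\<close>; it also keeps the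
  solution in the ellipsoid, where the hypothesis applies again. That the origin is an equilibrium
  follows from the decrease at \<open>x = 0\<close>, because \<open>V\<close> vanishes only there.\<close>

lemma lyapunov_decrease_imp_stable_and_attracting:
  fixes \<pi> :: "real Matrix.vec \<Rightarrow> real Matrix.vec" and A B P :: "real mat"
  defines "V \<equiv> \<lambda>x. x \<bullet> (P *\<^sub>v x)"
  assumes P: "P \<in> carrier_mat n n" "pos_def P"
    and closed: "\<And>x. x \<in> carrier_vec n \<Longrightarrow> closed_loop \<pi> A B x \<in> carrier_vec n"
    and \<mu>: "0 < \<mu>"
    and decr: "\<And>x. x \<in> carrier_vec n \<Longrightarrow> V x \<le> 1 \<Longrightarrow> V (closed_loop \<pi> A B x) \<le> V x - \<mu> * (x \<bullet> x)"
  shows "lyapunov_stable n \<pi> A B (0\<^sub>v n)"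
    and "x0 \<in> ellipsoid n P (0\<^sub>v n) \<Longrightarrow> vec_tendsto (solution \<pi> A B x0) (0\<^sub>v n)"
proof -
  have pos: "0 < x \<bullet> (P *\<^sub>v x)" if "x \<in> carrier_vec n" "x \<noteq> 0\<^sub>v n" for x
    using P that by (simp add: pos_def_def)
  obtain c where c: "0 < c" "\<And>x. x \<in> carrier_vec n \<Longrightarrow> c * (x \<bullet> x) \<le> V x"
    using pos_form_coercive[OF P(1) pos] unfolding V_def by blast
  obtain C where C: "0 < C" "\<And>x. x \<in> carrier_vec n \<Longrightarrow> V x \<le> C * (x \<bullet> x)"
    using quadratic_form_bounded[OF P(1)] unfolding V_def by blast
  \<comment> \<open>Enlarging \<open>C\<close> to at least \<open>\<mu>\<close> keeps the contraction factor nonnegative.\<close>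
  define q where "q = 1 - \<mu> / max C \<mu>"
  have q: "0 \<le> q" "q < 1" using \<mu> C(1) by (auto simp: q_def field_simps)
  have V_nonneg: "0 \<le> V x" if "x \<in> carrier_vec n" for x
    using c(2)[OF that] c(1) scalar_prod_self_nonneg[of x] by (meson mult_nonneg_nonneg less_imp_le order_trans)
  have contract: "V (closed_loop \<pi> A B x) \<le> q * V x" if x: "x \<in> carrier_vec n" and "V x \<le> 1" for x
  proof -
    have "V x \<le> max C \<mu> * (x \<bullet> x)"
      using C(2)[OF x] by (rule order_trans) (intro mult_right_mono scalar_prod_self_nonneg, simp)
    then have "\<mu> / max C \<mu> * V x \<le> \<mu> / max C \<mu> * (max C \<mu> * (x \<bullet> x))"
      using \<mu> C(1) by (intro mult_left_mono) auto
    also have "\<dots> = \<mu> * (x \<bullet> x)" using \<mu> by (simp add: less_max_iff_disj)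
    finally show ?thesis using decr[OF that] by (simp add: q_def algebra_simps)
  qed
  have sol: "solution \<pi> A B x t \<in> carrier_vec n" if "x \<in> carrier_vec n" for x t
    by (induction t) (use that closed in auto)
  have decay: "V (solution \<pi> A B x t) \<le> q ^ t * V x" if x: "x \<in> carrier_vec n" and V: "V x \<le> 1" for x t
  proof (induction t)
    case (Suc t)
    have "q ^ t * V x \<le> 1"
      using q V V_nonneg[OF x] by (intro mult_le_one power_le_one) auto
    then have "V (solution \<pi> A B x (Suc t)) \<le> q * V (solution \<pi> A B x t)"
      using Suc.IH by (auto intro!: contract sol x)
    also have "\<dots> \<le> q * (q ^ t * V x)" using q Suc.IH by (intro mult_left_mono)
    finally show ?case by (simp add: mult.assoc)
  qed simp
  have norm_decay: "(vnorm (solution \<pi> A B x t - 0\<^sub>v n))\<^sup>2 \<le> q ^ t * V x / c"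
    if x: "x \<in> carrier_vec n" and V: "V x \<le> 1" for x t
  proof -
    have "c * (vnorm (solution \<pi> A B x t - 0\<^sub>v n))\<^sup>2 \<le> q ^ t * V x"
      using c(2)[OF sol[OF x, of t]] decay[OF x V, of t] sol[OF x, of t]
      by (simp add: vnorm_def scalar_prod_self_nonneg)
    then show ?thesis using c(1) by (simp add: field_simps)
  qed
  show "vec_tendsto (solution \<pi> A B x0) (0\<^sub>v n)" if "x0 \<in> ellipsoid n P (0\<^sub>v n)"
  proof -
    have x0: "x0 \<in> carrier_vec n" "V x0 \<le> 1" using that by (auto simp: ellipsoid_def V_def)
    have "(\<lambda>t. q ^ t * (V x0 / c)) \<longlonglongrightarrow> 0"
      using q by (intro tendsto_mult_left_zero LIMSEQ_power_zero) auto
    then have "(\<lambda>t. (vnorm (solution \<pi> A B x0 t - 0\<^sub>v n))\<^sup>2) \<longlonglongrightarrow> 0"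
      by (rule tendsto_sandwich[OF _ _ tendsto_const, rotated -1])
        (use norm_decay[OF x0] in \<open>auto intro!: always_eventually\<close>)
    from tendsto_real_sqrt[OF this] show ?thesis
      by (simp add: vec_tendsto_def vnorm_nonneg)
  qed
  show "lyapunov_stable n \<pi> A B (0\<^sub>v n)"
    unfolding lyapunov_stable_def
  proof (intro conjI allI impI)
    have V0: "V (0\<^sub>v n) = 0" using P(1) by (simp add: V_def)
    have "V (closed_loop \<pi> A B (0\<^sub>v n)) \<le> 0" using decr[of "0\<^sub>v n"] V0 by simp
    then show "closed_loop \<pi> A B (0\<^sub>v n) = 0\<^sub>v n"
      using pos[OF closed[of "0\<^sub>v n"]] unfolding V_def by force
  next
    fix \<epsilon> :: real assume \<epsilon>: "0 < \<epsilon>"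
    \<comment> \<open>On the ball of radius \<open>\<delta>\<close>, \<open>V < 1\<close> makes the decay estimate applicable, and
      \<open>V < c \<epsilon>\<^sup>2\<close> makes it good enough.\<close>
    define \<delta> where "\<delta> = sqrt (min 1 (c * \<epsilon>\<^sup>2) / C)"
    have \<delta>: "0 < \<delta>" "C * \<delta>\<^sup>2 = min 1 (c * \<epsilon>\<^sup>2)" using \<epsilon> c(1) C(1) by (auto simp: \<delta>_def)
    have "vnorm (solution \<pi> A B x t - 0\<^sub>v n) < \<epsilon>"
      if x: "x \<in> carrier_vec n" and small: "vnorm (x - 0\<^sub>v n) < \<delta>" for x t
    proof -
      have xx: "x \<bullet> x = (vnorm (x - 0\<^sub>v n))\<^sup>2" using x by (simp add: vnorm_def scalar_prod_self_nonneg)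
      then have "x \<bullet> x < \<delta>\<^sup>2"
        using small by (auto intro: power_strict_mono vnorm_nonneg)
      then have "V x < C * \<delta>\<^sup>2" using C(1) by (intro le_less_trans[OF C(2)[OF x]]) simp
      then have V: "V x < 1" "V x < c * \<epsilon>\<^sup>2" using \<delta>(2) by auto
      have "(vnorm (solution \<pi> A B x t - 0\<^sub>v n))\<^sup>2 \<le> q ^ t * V x / c" using norm_decay[OF x] V by simp
      also have "\<dots> \<le> V x / c"
        using q c(1) V_nonneg[OF x] by (intro divide_right_mono mult_left_le_one_le power_le_one) auto
      also have "\<dots> < \<epsilon>\<^sup>2" using V(2) c(1) by (simp add: field_simps)
      finally show ?thesis by (rule power_less_imp_less_base) (use \<epsilon> in auto)
    qed
    with \<delta>(1) show "\<exists>\<delta>>0. \<forall>x0\<in>carrier_vec n. vnorm (x0 - 0\<^sub>v n) < \<delta> \<longrightarrow>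
        (\<forall>t. vnorm (solution \<pi> A B x0 t - 0\<^sub>v n) < \<epsilon>)" by blast
  qed
qed

section \<open>The network as a linear map with sector nonlinearities\<close>

lemma layer_out_carrier:
  assumes "network n m l d W b" "x \<in> carrier_vec n" "i \<le> l"
  shows "layer_out W b \<phi> i x \<in> carrier_vec (d i)"
proof (cases i)
  case 0
  then show ?thesis using assms by (simp add: network_def)
next
  case (Suc j)
  then have "b i \<in> carrier_vec (d i)" using assms by (simp add: network_def)
  then show ?thesis using Suc by (intro carrier_vecI) simp
qed

lemma layer_in_carrier:
  assumes "network n m l d W b" "1 \<le> i" "i \<le> l"
  shows "layer_in W b \<phi> i x \<in> carrier_vec (d i)"
proof -
  have "b i \<in> carrier_vec (d i)" using assms by (simp add: network_def)
  then show ?thesis by (intro carrier_vecI) (simp add: layer_in_def)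
qed

lemma v_phi_carrier: "network n m l d W b \<Longrightarrow> v_phi l W b \<phi> x \<in> carrier_vec (nphi d l)"
  unfolding v_phi_def by (intro stack_carrier layer_in_carrier)

lemma w_phi_carrier:
  "network n m l d W b \<Longrightarrow> x \<in> carrier_vec n \<Longrightarrow> w_phi l W b \<phi> x \<in> carrier_vec (nphi d l)"
  unfolding w_phi_def by (intro stack_carrier layer_out_carrier)

lemma map_vec_append: "map_vec f (x @\<^sub>v y) = map_vec f x @\<^sub>v map_vec f y"
  by (intro eq_vecI) auto

lemma w_phi_eq_map_v_phi: "w_phi l W b \<phi> x = map_vec \<phi> (v_phi l W b \<phi> x)"
proof (induction l)
  case 0
  show ?case by (auto simp: w_phi_def v_phi_def)
next
  case (Suc l)
  then show ?case by (simp add: w_phi_def v_phi_def map_vec_append layer_in_def)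
qed

lemma network_matrix_carriers:
  assumes "network n m l d W b"
  shows "N_vx n l d W \<in> carrier_mat (nphi d l) n" "N_vw l d W \<in> carrier_mat (nphi d l) (nphi d l)"
    and "N_ux n m \<in> carrier_mat m n" "N_uw m l d W \<in> carrier_mat m (nphi d l)"
proof -
  obtain k where l: "l = Suc k" using assms by (cases l) (auto simp: network_def)
  have d0: "d 0 = n" and Wl: "W (l + 1) \<in> carrier_mat m (d l)"
    and layers: "\<forall>i \<in> {1..l}. W i \<in> carrier_mat (d i) (d (i - 1)) \<and> b i \<in> carrier_vec (d i)"
    using assms by (auto simp: network_def)
  have W1: "W 1 \<in> carrier_mat (d 1) n" using layers[rule_format, of 1] d0 by (simp add: l)
  have "d 1 \<le> nphi d l" unfolding nphi_def l by (rule member_le_sum) auto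
  then show "N_vx n l d W \<in> carrier_mat (nphi d l) n"
    unfolding N_vx_def using carrier_append_rows[OF W1 zero_carrier_mat, of "nphi d l - d 1"] by simp
  show "N_vw l d W \<in> carrier_mat (nphi d l) (nphi d l)"
    unfolding l by (rule v_phi_affine_aux[of k W d b "0\<^sub>v (d 0)" "\<lambda>_. 0", THEN conjunct2])
      (use layers l in simp_all)
  show "N_ux n m \<in> carrier_mat m n" by (simp add: N_ux_def)
  show "N_uw m l d W \<in> carrier_mat m (nphi d l)"
    using Wl unfolding N_uw_def append_cols_def by (auto simp: l nphi_def)
qed

lemma affine_diff:
  fixes M N :: "real mat"
  assumes M: "M \<in> carrier_mat r p" and N: "N \<in> carrier_mat r q" and c: "c \<in> carrier_vec r"
    and x: "x \<in> carrier_vec p" "x' \<in> carrier_vec p" and w: "w \<in> carrier_vec q" "w' \<in> carrier_vec q"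
  shows "(M *\<^sub>v x + N *\<^sub>v w + c) - (M *\<^sub>v x' + N *\<^sub>v w' + c) = M *\<^sub>v (x - x') + N *\<^sub>v (w - w')"
  unfolding mult_minus_distrib_mat_vec[OF M x] mult_minus_distrib_mat_vec[OF N w]
  using M N c by (intro eq_vecI) auto

text \<open>Subtracting the affine network identities at \<open>0\<close> from those at \<open>x\<close> removes the biases; the output
  needs no subtraction because it vanishes at \<open>0\<close>.\<close>

lemma network_increments:
  assumes net: "network n m l d W b" and x: "x \<in> carrier_vec n" and pi0: "nn l W b \<phi> (0\<^sub>v n) = 0\<^sub>v m"
  defines "\<Delta>w \<equiv> w_phi l W b \<phi> x - w_phi l W b \<phi> (0\<^sub>v n)"
  shows "v_phi l W b \<phi> x - v_phi l W b \<phi> (0\<^sub>v n) = N_vx n l d W *\<^sub>v x + N_vw l d W *\<^sub>v \<Delta>w"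
    and "nn l W b \<phi> x = N_ux n m *\<^sub>v x + N_uw m l d W *\<^sub>v \<Delta>w"
proof -
  note N = network_matrix_carriers[OF net]
  have w: "w_phi l W b \<phi> x \<in> carrier_vec (nphi d l)" "w_phi l W b \<phi> (0\<^sub>v n) \<in> carrier_vec (nphi d l)"
    using w_phi_carrier[OF net] x by simp_all
  have c: "stack b l \<in> carrier_vec (nphi d l)" "b (l + 1) \<in> carrier_vec m"
    using net by (auto simp: network_def intro!: stack_carrier)
  have x0: "0\<^sub>v n \<in> carrier_vec n" "x - 0\<^sub>v n = x" using x by auto
  show "v_phi l W b \<phi> x - v_phi l W b \<phi> (0\<^sub>v n) = N_vx n l d W *\<^sub>v x + N_vw l d W *\<^sub>v \<Delta>w"
    unfolding network_affine(2)[OF net x] network_affine(2)[OF net x0(1)] \<Delta>w_def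
      affine_diff[OF N(1,2) c(1) x x0(1) w] x0(2) ..
  have "nn l W b \<phi> x - nn l W b \<phi> (0\<^sub>v n) = N_ux n m *\<^sub>v x + N_uw m l d W *\<^sub>v \<Delta>w"
    unfolding network_affine(1)[OF net x] network_affine(1)[OF net x0(1)] \<Delta>w_def
      affine_diff[OF N(3,4) c(2) x x0(1) w] x0(2) ..
  moreover have "nn l W b \<phi> x \<in> carrier_vec m"
    using c(2) by (intro carrier_vecI) (simp add: nn_def)
  ultimately show "nn l W b \<phi> x = N_ux n m *\<^sub>v x + N_uw m l d W *\<^sub>v \<Delta>w"
    by (simp add: pi0)
qed

section \<open>The quadratic form of the stability matrix\<close>

lemma diag_of_carrier: "v \<in> carrier_vec k \<Longrightarrow> diag_of v \<in> carrier_mat k k"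
  by (simp add: diag_of_def)

lemma diag_of_mult_vec:
  assumes "v \<in> carrier_vec k" "x \<in> carrier_vec k"
  shows "diag_of v *\<^sub>v x = Matrix.vec k (\<lambda>i. v $ i * x $ i)"
proof (rule eq_vecI)
  fix i assume "i < dim_vec (Matrix.vec k (\<lambda>i. v $ i * x $ i))"
  then have i: "i < k" by simp
  have "(diag_of v *\<^sub>v x) $ i = (\<Sum>j = 0..<k. (if i = j then v $ j else 0) * x $ j)"
    using assms i by (auto simp: diag_of_def mat_diag_def scalar_prod_def intro!: sum.cong)
  also have "\<dots> = (\<Sum>j = 0..<k. if i = j then v $ j * x $ j else 0)"
    by (intro sum.cong) auto
  finally show "(diag_of v *\<^sub>v x) $ i = Matrix.vec k (\<lambda>i. v $ i * x $ i) $ i"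
    using i by simp
qed (use diag_of_carrier[OF assms(1)] in simp)

text \<open>The factors act one after the other: \<open>R_phi\<close> sends \<open>(x, w)\<close> to \<open>(v, w)\<close>, \<open>Psi_phi\<close> sends this
  to the two sector deviations \<open>(\<beta> v - w, w - \<alpha> v)\<close>, and \<open>M_phi\<close> pairs these with weights
  \<open>lam\<close>, each product occurring twice.\<close>

lemma X_mat_quadratic_form:
  assumes net: "network n m l d W b"
    and dims: "\<alpha> \<in> carrier_vec (nphi d l)" "\<beta> \<in> carrier_vec (nphi d l)" "lam \<in> carrier_vec (nphi d l)"
    and x: "x \<in> carrier_vec n" and w: "w \<in> carrier_vec (nphi d l)"
  defines "v \<equiv> N_vx n l d W *\<^sub>v x + N_vw l d W *\<^sub>v w"
  shows "X_mat n l d W \<alpha> \<beta> lam \<in> carrier_mat (n + nphi d l) (n + nphi d l)"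
    and "(x @\<^sub>v w) \<bullet> (X_mat n l d W \<alpha> \<beta> lam *\<^sub>v (x @\<^sub>v w)) =
      2 * (\<Sum>i<nphi d l. lam $ i * ((\<beta> $ i * v $ i - w $ i) * (w $ i - \<alpha> $ i * v $ i)))"
proof -
  define k where "k = nphi d l"
  define R where "R = R_phi n l d W"
  define Psi where "Psi = Psi_phi k \<alpha> \<beta>"
  define M where "M = M_phi k lam"
  note N = network_matrix_carriers[OF net, folded k_def]
  note dims = dims[folded k_def] and w = w[folded k_def]
  have R: "R \<in> carrier_mat (k + k) (n + k)"
    unfolding R_def R_phi_def using N by (auto simp: k_def[symmetric])
  have Psi: "Psi \<in> carrier_mat (k + k) (k + k)" and M: "M \<in> carrier_mat (k + k) (k + k)"
    unfolding Psi_def Psi_phi_def M_def M_phi_def using dims by (auto simp: diag_of_def)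
  have PR: "Psi * R \<in> carrier_mat (k + k) (n + k)" using Psi R by simp
  have X: "X_mat n l d W \<alpha> \<beta> lam = transpose_mat (Psi * R) * M * (Psi * R)"
  proof -
    have c: "transpose_mat R * transpose_mat Psi \<in> carrier_mat (n + k) (k + k)"
      "transpose_mat R * transpose_mat Psi * M \<in> carrier_mat (n + k) (k + k)"
      using R Psi M by auto
    show ?thesis
      unfolding X_mat_def Let_def k_def[symmetric] R_def[symmetric] Psi_def[symmetric] M_def[symmetric]
        transpose_mult[OF Psi R] by (rule assoc_mult_mat[OF c(2) Psi R])
  qed
  show "X_mat n l d W \<alpha> \<beta> lam \<in> carrier_mat (n + nphi d l) (n + nphi d l)"
    unfolding X k_def[symmetric] by (rule congruence_carrier[OF PR M])
  have v: "v \<in> carrier_vec k" unfolding v_def using N x w by auto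
  have xw: "x @\<^sub>v w \<in> carrier_vec (n + k)" using x w by simp
  have Rxw: "R *\<^sub>v (x @\<^sub>v w) = v @\<^sub>v w"
    unfolding R_def R_phi_def k_def[symmetric] using N x w
    by (subst four_block_mult_vec[of _ k n _ k _ k]) (auto simp: v_def zero_mult_vec)
  define p where "p = Matrix.vec k (\<lambda>i. \<beta> $ i * v $ i - w $ i)"
  define q where "q = Matrix.vec k (\<lambda>i. w $ i - \<alpha> $ i * v $ i)"
  have pq: "p \<in> carrier_vec k" "q \<in> carrier_vec k" by (simp_all add: p_def q_def)
  have "Psi *\<^sub>v (v @\<^sub>v w) = (diag_of \<beta> *\<^sub>v v + - 1\<^sub>m k *\<^sub>v w) @\<^sub>v (- diag_of \<alpha> *\<^sub>v v + 1\<^sub>m k *\<^sub>v w)"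
    unfolding Psi_def Psi_phi_def using v w dims diag_of_carrier
    by (intro four_block_mult_vec[of _ k k _ k _ k]) auto
  also have "\<dots> = p @\<^sub>v q"
  proof -
    have "diag_of \<beta> *\<^sub>v v + - 1\<^sub>m k *\<^sub>v w = p"
      using v w dims diag_of_mult_vec[OF dims(2) v] by (intro eq_vecI) (auto simp: p_def)
    moreover have "- diag_of \<alpha> *\<^sub>v v + 1\<^sub>m k *\<^sub>v w = q"
      using v w dims diag_of_mult_vec[OF dims(1) v] diag_of_carrier[OF dims(1)]
      by (intro eq_vecI) (auto simp: q_def)
    ultimately show ?thesis by simp
  qed
  finally have PRz: "(Psi * R) *\<^sub>v (x @\<^sub>v w) = p @\<^sub>v q"
    using assoc_mult_mat_vec[OF Psi R xw] Rxw by simp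
  have "M *\<^sub>v (p @\<^sub>v q) = diag_of lam *\<^sub>v q @\<^sub>v diag_of lam *\<^sub>v p"
    unfolding M_def M_phi_def using pq diag_of_carrier[OF dims(3)]
    by (subst four_block_mult_vec[of _ k k _ k _ k])
      (auto simp: zero_mult_vec left_zero_vec[of _ k] right_zero_vec[of _ k])
  then have "(x @\<^sub>v w) \<bullet> (X_mat n l d W \<alpha> \<beta> lam *\<^sub>v (x @\<^sub>v w)) = (p @\<^sub>v q) \<bullet> (diag_of lam *\<^sub>v q @\<^sub>v diag_of lam *\<^sub>v p)"
    unfolding X congruence_quadratic_form[OF PR M xw] PRz by simp
  also have "\<dots> = p \<bullet> (diag_of lam *\<^sub>v q) + q \<bullet> (diag_of lam *\<^sub>v p)"
    using pq diag_of_carrier[OF dims(3)] by (intro scalar_prod_append[of _ k _ k]) auto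
  also have "\<dots> = 2 * (\<Sum>i<k. lam $ i * (p $ i * q $ i))"
    unfolding diag_of_mult_vec[OF dims(3) pq(1)] diag_of_mult_vec[OF dims(3) pq(2)]
    by (simp add: scalar_prod_def lessThan_atLeast0 mult_ac)
  finally show "(x @\<^sub>v w) \<bullet> (X_mat n l d W \<alpha> \<beta> lam *\<^sub>v (x @\<^sub>v w)) =
      2 * (\<Sum>i<nphi d l. lam $ i * ((\<beta> $ i * v $ i - w $ i) * (w $ i - \<alpha> $ i * v $ i)))"
    by (simp add: p_def q_def k_def)
qed

lemma stability_lmi_quadratic_form:
  assumes net: "network n m l d W b"
    and dims: "\<alpha> \<in> carrier_vec (nphi d l)" "\<beta> \<in> carrier_vec (nphi d l)" "lam \<in> carrier_vec (nphi d l)"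
    and P: "P \<in> carrier_mat n n" and A: "A \<in> carrier_mat n n" and B: "B \<in> carrier_mat n m"
    and x: "x \<in> carrier_vec n" and w: "w \<in> carrier_vec (nphi d l)" and y: "y \<in> carrier_vec n"
  defines "v \<equiv> N_vx n l d W *\<^sub>v x + N_vw l d W *\<^sub>v w"
    and "u \<equiv> N_ux n m *\<^sub>v x + N_uw m l d W *\<^sub>v w"
    and "k \<equiv> n + nphi d l + n"
  shows "stability_lmi n m l d W \<alpha> \<beta> lam P A B \<in> carrier_mat k k"
    and "((x @\<^sub>v w) @\<^sub>v y) \<bullet> (stability_lmi n m l d W \<alpha> \<beta> lam P A B *\<^sub>v ((x @\<^sub>v w) @\<^sub>v y)) =
      - (x \<bullet> (P *\<^sub>v x))
      + 2 * (\<Sum>i<nphi d l. lam $ i * ((\<beta> $ i * v $ i - w $ i) * (w $ i - \<alpha> $ i * v $ i)))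
      + 2 * (y \<bullet> (P *\<^sub>v (A *\<^sub>v x + B *\<^sub>v u))) - y \<bullet> (P *\<^sub>v y)"
proof -
  define h where "h = nphi d l"
  define R where "R = R_V n m l d W"
  define E where "E = (1\<^sub>m n @\<^sub>r 0\<^sub>m m n :: real mat)"
  define F where "F = (1\<^sub>m n @\<^sub>c 0\<^sub>m n m :: real mat)"
  define X where "X = X_mat n l d W \<alpha> \<beta> lam"
  define T where "T = - (transpose_mat R * E * P * F * R) + X"
  define S where "S = P * (A @\<^sub>c B) * R"
  note N = network_matrix_carriers[OF net, folded h_def]
  note w = w[folded h_def]
  have R: "R \<in> carrier_mat (n + m) (n + h)"
    unfolding R_def R_V_def using N by (auto simp: h_def[symmetric])
  have E: "E \<in> carrier_mat (n + m) n" unfolding E_def by (intro carrier_append_rows) auto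
  have F: "F \<in> carrier_mat n (n + m)" unfolding F_def append_cols_def by auto
  have AB: "A @\<^sub>c B \<in> carrier_mat n (n + m)" unfolding append_cols_def using A B by auto
  have EPF: "E * P * F \<in> carrier_mat (n + m) (n + m)" using E P F by auto
  have X: "X \<in> carrier_mat (n + h) (n + h)"
    unfolding X_def h_def by (rule X_mat_quadratic_form(1)[OF net dims x w[unfolded h_def]])
  have REPFR: "transpose_mat R * (E * P * F) * R \<in> carrier_mat (n + h) (n + h)"
    by (rule congruence_carrier[OF R EPF])
  have assoc: "transpose_mat R * E * P * F * R = transpose_mat R * (E * P * F) * R"
  proof -
    have Rt: "transpose_mat R \<in> carrier_mat (n + h) (n + m)" using R by simp
    have "transpose_mat R * E * P * F = transpose_mat R * (E * P) * F"
      by (simp only: assoc_mult_mat[OF Rt E P])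
    also have "\<dots> = transpose_mat R * (E * P * F)"
      by (rule assoc_mult_mat[OF Rt mult_carrier_mat[OF E P] F])
    finally show ?thesis by simp
  qed
  have T: "T \<in> carrier_mat (n + h) (n + h)"
    unfolding T_def assoc using REPFR X by auto
  have S: "S \<in> carrier_mat n (n + h)"
    unfolding S_def using P AB R by (intro mult_carrier_mat)
  have mP: "- P \<in> carrier_mat n n" using P by simp
  have L: "stability_lmi n m l d W \<alpha> \<beta> lam P A B = four_block_mat T (transpose_mat S) S (- P)"
    unfolding stability_lmi_def Let_def T_def S_def R_def E_def F_def X_def ..
  show "stability_lmi n m l d W \<alpha> \<beta> lam P A B \<in> carrier_mat k k"
    unfolding L k_def h_def[symmetric] using T mP by (intro four_block_carrier_mat)
  have xw: "x @\<^sub>v w \<in> carrier_vec (n + h)" using x w by simp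
  have u: "u \<in> carrier_vec m" unfolding u_def using N x w by auto
  have xu: "x @\<^sub>v u \<in> carrier_vec (n + m)" using x u by simp
  have Rxw: "R *\<^sub>v (x @\<^sub>v w) = x @\<^sub>v u"
    unfolding R_def R_V_def h_def[symmetric] using N x w
    by (subst four_block_mult_vec[of _ n n _ h _ m]) (auto simp: u_def zero_mult_vec)
  have Px: "P *\<^sub>v x \<in> carrier_vec n" using P x by simp
  have EPFxu: "(E * P * F) *\<^sub>v (x @\<^sub>v u) = (P *\<^sub>v x) @\<^sub>v 0\<^sub>v m"
  proof -
    have "F *\<^sub>v (x @\<^sub>v u) = x"
      unfolding F_def using x u by (subst append_cols_mult_vec[of _ n n _ m]) (auto simp: zero_mult_vec)
    moreover have "E *\<^sub>v (P *\<^sub>v x) = (P *\<^sub>v x) @\<^sub>v 0\<^sub>v m"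
      unfolding E_def using Px by (subst mat_mult_append[of _ n n _ m]) (auto simp: zero_mult_vec)
    ultimately show ?thesis
      by (simp only: assoc_mult_mat_vec[OF mult_carrier_mat[OF E P] F xu] assoc_mult_mat_vec[OF E P x])
  qed
  have "(x @\<^sub>v w) \<bullet> ((transpose_mat R * (E * P * F) * R) *\<^sub>v (x @\<^sub>v w)) = (x @\<^sub>v u) \<bullet> ((P *\<^sub>v x) @\<^sub>v 0\<^sub>v m)"
    by (simp only: congruence_quadratic_form[OF R EPF xw] Rxw EPFxu)
  also have "\<dots> = x \<bullet> (P *\<^sub>v x)"
    using x u Px by (subst scalar_prod_append[of _ n _ m]) auto
  finally have quadE: "(x @\<^sub>v w) \<bullet> ((transpose_mat R * (E * P * F) * R) *\<^sub>v (x @\<^sub>v w)) = x \<bullet> (P *\<^sub>v x)" .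
  have nc: "- (transpose_mat R * (E * P * F) * R) \<in> carrier_mat (n + h) (n + h)"
    using REPFR by simp
  have "(x @\<^sub>v w) \<bullet> (T *\<^sub>v (x @\<^sub>v w)) = - (x \<bullet> (P *\<^sub>v x)) + (x @\<^sub>v w) \<bullet> (X *\<^sub>v (x @\<^sub>v w))"
    unfolding T_def assoc add_mult_distrib_mat_vec[OF nc X xw] 
      scalar_prod_add_distrib[OF xw mult_mat_vec_carrier[OF nc xw] mult_mat_vec_carrier[OF X xw]]
      scalar_prod_uminus_mat[OF REPFR xw xw] quadE ..
  moreover have "S *\<^sub>v (x @\<^sub>v w) = P *\<^sub>v (A *\<^sub>v x + B *\<^sub>v u)"
    unfolding S_def
    by (simp only: assoc_mult_mat_vec[OF mult_carrier_mat[OF P AB] R xw] Rxw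
        assoc_mult_mat_vec[OF P AB xu] append_cols_mult_vec[OF A B x u])
  moreover have "y \<bullet> (- P *\<^sub>v y) = - (y \<bullet> (P *\<^sub>v y))"
    by (rule scalar_prod_uminus_mat[OF P y y])
  ultimately show "((x @\<^sub>v w) @\<^sub>v y) \<bullet> (stability_lmi n m l d W \<alpha> \<beta> lam P A B *\<^sub>v ((x @\<^sub>v w) @\<^sub>v y)) =
      - (x \<bullet> (P *\<^sub>v x))
      + 2 * (\<Sum>i<nphi d l. lam $ i * ((\<beta> $ i * v $ i - w $ i) * (w $ i - \<alpha> $ i * v $ i)))
      + 2 * (y \<bullet> (P *\<^sub>v (A *\<^sub>v x + B *\<^sub>v u))) - y \<bullet> (P *\<^sub>v y)"
    unfolding L quadratic_form_four_block[OF T S mP xw y] X_def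
      X_mat_quadratic_form(2)[OF net dims x w[unfolded h_def]] v_def by simp
qed

section \<open>From the vertices to the whole interval\<close>

lemma interval_mat_carrier:
  fixes L :: "real mat"
  shows "L \<in> carrier_mat r c \<Longrightarrow> A \<in> {L..U} \<Longrightarrow> A \<in> carrier_mat r c"
  unfolding less_eq_mat_def atLeastAtMost_iff by (intro carrier_matI) simp_all

lemma interval_vertices_carrier: "L \<in> carrier_mat r c \<Longrightarrow> A \<in> interval_vertices L U \<Longrightarrow> A \<in> carrier_mat r c"
  by (simp add: interval_vertices_def)

text \<open>The form is linear in each entry of the matrix with coefficient \<open>p\<^sub>i x\<^sub>j\<close>, so the sign of this
  coefficient says which end of the entry interval maximises it. The vertex depends on \<open>p\<close> and
  \<open>x\<close>, which is harmless since definiteness is tested one vector at a time.\<close>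

lemma interval_form_le_vertex:
  assumes "L \<in> carrier_mat r c" "U \<in> carrier_mat r c" "A \<in> {L..U}"
    and "p \<in> carrier_vec r" "x \<in> carrier_vec c"
  obtains A' where "A' \<in> interval_vertices L U" "p \<bullet> (A *\<^sub>v x) \<le> p \<bullet> (A' *\<^sub>v x)"
proof
  have LA: "L \<le> A" and AU: "A \<le> U" using assms(3) by simp_all
  have A: "A \<in> carrier_mat r c"
    using LA assms(1) unfolding less_eq_mat_def by (intro carrier_matI) simp_all
  have bnd: "L $$ (i,j) \<le> A $$ (i,j)" "A $$ (i,j) \<le> U $$ (i,j)" if "i < r" "j < c" for i j
    using LA AU assms(2) A that unfolding less_eq_mat_def by simp_all
  define A' where "A' = Matrix.mat r c (\<lambda>(i,j). if 0 \<le> p $ i * x $ j then U $$ (i,j) else L $$ (i,j))"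
  have A': "A' \<in> carrier_mat r c" by (simp add: A'_def)
  show "A' \<in> interval_vertices L U"
    using assms(1) by (auto simp: interval_vertices_def A'_def)
  show "p \<bullet> (A *\<^sub>v x) \<le> p \<bullet> (A' *\<^sub>v x)"
    unfolding scalar_prod_mat_vec_sum[OF A assms(4,5)] scalar_prod_mat_vec_sum[OF A' assms(4,5)]
  proof (intro sum_mono)
    fix i j assume "i \<in> {..<r}" "j \<in> {..<c}"
    then have ij: "i < r" "j < c" by simp_all
    show "p $ i * x $ j * A $$ (i,j) \<le> p $ i * x $ j * A' $$ (i,j)"
    proof (cases "0 \<le> p $ i * x $ j")
      case True
      then show ?thesis using ij bnd(2)[OF ij] by (simp add: A'_def mult_left_mono)
    next
      case False
      then show ?thesis using ij bnd(1)[OF ij] by (simp add: A'_def mult_left_mono_neg)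
    qed
  qed
qed

text \<open>The matrices \<open>A\<close> and \<open>B\<close> enter the form at \<open>z = (x, w, y)\<close> only through
  \<open>(P\<^sup>T y) \<bullet> (A x)\<close> and \<open>(P\<^sup>T y) \<bullet> (B u)\<close>, so they can be replaced by maximising
  vertices independently of each other.\<close>

lemma stability_lmi_vertices_imp_interval:
  assumes net: "network n m l d W b"
    and dims: "\<alpha> \<in> carrier_vec (nphi d l)" "\<beta> \<in> carrier_vec (nphi d l)" "lam \<in> carrier_vec (nphi d l)"
    and P: "P \<in> carrier_mat n n"
    and A_dims: "Alo \<in> carrier_mat n n" "Ahi \<in> carrier_mat n n"
    and B_dims: "Blo \<in> carrier_mat n m" "Bhi \<in> carrier_mat n m"
    and vertices: "\<forall>A \<in> interval_vertices Alo Ahi. \<forall>B \<in> interval_vertices Blo Bhi.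
           neg_def (stability_lmi n m l d W \<alpha> \<beta> lam P A B)"
    and A: "A \<in> {Alo..Ahi}" and B: "B \<in> {Blo..Bhi}"
    and z: "z \<in> carrier_vec (n + nphi d l + n)" "z \<noteq> 0\<^sub>v (n + nphi d l + n)"
  shows "0 < z \<bullet> (- stability_lmi n m l d W \<alpha> \<beta> lam P A B *\<^sub>v z)"
proof -
  define k where "k = n + nphi d l + n"
  define L where "L = stability_lmi n m l d W \<alpha> \<beta> lam P"
  define x where "x = vec_first (vec_first z (n + nphi d l)) n"
  define w where "w = vec_last (vec_first z (n + nphi d l)) (nphi d l)"
  define y where "y = vec_last z n"
  have xwy: "x \<in> carrier_vec n" "w \<in> carrier_vec (nphi d l)" "y \<in> carrier_vec n"
    by (simp_all add: x_def w_def y_def)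
  have z_eq: "z = (x @\<^sub>v w) @\<^sub>v y"
    using z(1) by (simp add: x_def w_def y_def)
  define u where "u = N_ux n m *\<^sub>v x + N_uw m l d W *\<^sub>v w"
  define p where "p = transpose_mat P *\<^sub>v y"
  have u: "u \<in> carrier_vec m"
    using network_matrix_carriers[OF net] xwy unfolding u_def by auto
  have p: "p \<in> carrier_vec n" using P xwy(3) unfolding p_def by (intro mult_mat_vec_carrier) auto
  have Ac: "A \<in> carrier_mat n n" and Bc: "B \<in> carrier_mat n m"
    using interval_mat_carrier A B A_dims(1) B_dims(1) by blast+
  obtain A' where A': "A' \<in> interval_vertices Alo Ahi" "p \<bullet> (A *\<^sub>v x) \<le> p \<bullet> (A' *\<^sub>v x)"
    using interval_form_le_vertex[OF A_dims A p xwy(1)] by blast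
  obtain B' where B': "B' \<in> interval_vertices Blo Bhi" "p \<bullet> (B *\<^sub>v u) \<le> p \<bullet> (B' *\<^sub>v u)"
    using interval_form_le_vertex[OF B_dims B p u] by blast
  have Ac': "A' \<in> carrier_mat n n" and Bc': "B' \<in> carrier_mat n m"
    using interval_vertices_carrier A' B' A_dims(1) B_dims(1) by blast+
  have cross: "y \<bullet> (P *\<^sub>v (C *\<^sub>v x + D *\<^sub>v u)) = p \<bullet> (C *\<^sub>v x) + p \<bullet> (D *\<^sub>v u)"
    if "C \<in> carrier_mat n n" "D \<in> carrier_mat n m" for C D
  proof -
    have c: "C *\<^sub>v x \<in> carrier_vec n" "D *\<^sub>v u \<in> carrier_vec n" using that xwy u by auto
    show ?thesis
      unfolding p_def transpose_vec_mult_scalar[OF P add_carrier_vec[OF c] xwy(3), symmetric]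
      using p c by (intro scalar_prod_add_distrib[of _ n]) (auto simp: p_def)
  qed
  note form = stability_lmi_quadratic_form[OF net dims P _ _ xwy, folded u_def k_def L_def z_eq]
  have L: "L A B \<in> carrier_mat k k" "L A' B' \<in> carrier_mat k k"
    by (rule form(1)[OF Ac Bc], rule form(1)[OF Ac' Bc'])
  note z = z[folded k_def]
  have "neg_def (L A' B')" using vertices A'(1) B'(1) unfolding L_def by blast
  then have "0 < z \<bullet> (- L A' B' *\<^sub>v z)"
    using z L(2) unfolding neg_def_def pos_def_def by simp
  then have "z \<bullet> (L A' B' *\<^sub>v z) < 0"
    unfolding scalar_prod_uminus_mat[OF L(2) z(1) z(1)] by simp
  moreover have "z \<bullet> (L A B *\<^sub>v z) \<le> z \<bullet> (L A' B' *\<^sub>v z)"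
    unfolding form(2)[OF Ac Bc] form(2)[OF Ac' Bc'] cross[OF Ac Bc] cross[OF Ac' Bc']
    using A'(2) B'(2) by simp
  ultimately show ?thesis
    unfolding scalar_prod_uminus_mat[OF L(1) z(1) z(1), unfolded L_def] L_def by simp
qed

section \<open>Local sector bounds on the ellipsoid\<close>

text \<open>A direct form of the Schur complement argument that also covers a box of width zero. With
  \<open>y = (W 1 x)\<^sub>i\<close> and \<open>c\<close> the half width, semidefiniteness at the vector \<open>(s, x)\<close> reads
  \<open>0 \<le> c\<^sup>2 s\<^sup>2 + 2 s y + x \<bullet> P x\<close>. If \<open>\<bar>y\<bar> > c\<close>, then \<open>y \<noteq> 0\<close> and the choice \<open>s = - 1 / y\<close>
  makes the right-hand side at most \<open>c\<^sup>2 / y\<^sup>2 - 1 < 0\<close>.\<close>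

lemma bound_lmi_imp_abs_le:
  assumes psd: "pos_semidef (bound_lmi W vhi1 vs1 P i)"
    and W: "W 1 \<in> carrier_mat r n" and i: "i < r" and P: "P \<in> carrier_mat n n"
    and x: "x \<in> carrier_vec n" "x \<bullet> (P *\<^sub>v x) \<le> 1" and c: "vs1 $ i \<le> vhi1 $ i"
  shows "\<bar>(W 1 *\<^sub>v x) $ i\<bar> \<le> vhi1 $ i - vs1 $ i"
proof (rule ccontr)
  define c where "c = vhi1 $ i - vs1 $ i"
  define y where "y = (W 1 *\<^sub>v x) $ i"
  assume "\<not> ?thesis"
  then have "c < \<bar>y\<bar>" by (simp add: c_def y_def)
  then have cy: "c\<^sup>2 < y\<^sup>2" and y0: "y \<noteq> 0"
    using c by (auto simp: c_def abs_le_square_iff[symmetric] not_le[symmetric])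
  define s where "s = vec_of_list [- 1 / y]"
  define wt where "wt = transpose_mat (mat_of_row (Matrix.row (W 1) i))"
  define C where "C = Matrix.mat 1 1 (\<lambda>_. c\<^sup>2)"
  have s: "s \<in> carrier_vec 1" by (simp add: s_def)
  have wt: "wt \<in> carrier_mat n 1" using W i by (simp add: wt_def)
  have xws: "x \<bullet> (wt *\<^sub>v s) = - 1"
  proof -
    have "x \<bullet> (wt *\<^sub>v s) = (\<Sum>j<n. x $ j * W 1 $$ (i,j)) * (- 1 / y)"
      unfolding scalar_prod_mat_vec_sum[OF wt x(1) s] using W i
      by (simp add: s_def wt_def sum_distrib_right sum_distrib_left mult_ac)
    also have "(\<Sum>j<n. x $ j * W 1 $$ (i,j)) = y"
      using W i x(1) by (simp add: y_def scalar_prod_def lessThan_atLeast0 mult.commute)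
    finally show ?thesis using y0 by simp
  qed
  have C: "C \<in> carrier_mat 1 1" by (simp add: C_def)
  have sC: "s \<bullet> (C *\<^sub>v s) = c\<^sup>2 / y\<^sup>2"
    by (simp add: s_def C_def scalar_prod_def power2_eq_square)
  have sx: "s @\<^sub>v x \<in> carrier_vec (1 + n)" using s x(1) by (rule append_carrier_vec)
  have "bound_lmi W vhi1 vs1 P i = four_block_mat C (transpose_mat wt) wt P"
    by (simp add: bound_lmi_def Let_def C_def c_def wt_def)
  then have "0 \<le> (s @\<^sub>v x) \<bullet> (four_block_mat C (transpose_mat wt) wt P *\<^sub>v (s @\<^sub>v x))"
    using psd sx C P by (simp only: pos_semidef_def) simp
  also have "\<dots> = s \<bullet> (C *\<^sub>v s) + 2 * (x \<bullet> (wt *\<^sub>v s)) + x \<bullet> (P *\<^sub>v x)"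
    by (rule quadratic_form_four_block[OF C wt P s x(1)])
  finally have "1 \<le> c\<^sup>2 / y\<^sup>2" using x(2) xws sC by simp
  then show False using cy y0 by (simp add: field_simps)
qed

text \<open>The first-layer box is symmetric about \<open>vs1 = b 1\<close>, so the bound on \<open>\<bar>(W 1 x)\<^sub>i\<bar>\<close> gives both of
  its sides.\<close>

lemma ellipsoid_imp_v_phi_bounds:
  assumes net: "network n m l d W b"
    and vs1: "vs1 = layer_in W b \<phi> 1 (0\<^sub>v n)"
    and vhi1: "vhi1 \<in> carrier_vec (d 1)" "vs1 \<le> vhi1"
    and vlo1: "vlo1 = 2 \<cdot>\<^sub>v vs1 - vhi1"
    and propagation: "\<forall>x \<in> carrier_vec n. vlo1 \<le> W 1 *\<^sub>v x + b 1 \<and> W 1 *\<^sub>v x + b 1 \<le> vhi1 \<longrightarrow>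
           vlo \<le> v_phi l W b \<phi> x \<and> v_phi l W b \<phi> x \<le> vhi"
    and P: "P \<in> carrier_mat n n"
    and lmi: "\<forall>i < d 1. pos_semidef (bound_lmi W vhi1 vs1 P i)"
    and x: "x \<in> carrier_vec n" "x \<bullet> (P *\<^sub>v x) \<le> 1"
  shows "vlo \<le> v_phi l W b \<phi> x" "v_phi l W b \<phi> x \<le> vhi"
proof -
  have l: "1 \<le> l" and d0: "d 0 = n"
    and layers: "\<forall>i \<in> {1..l}. W i \<in> carrier_mat (d i) (d (i - 1)) \<and> b i \<in> carrier_vec (d i)"
    using net by (auto simp: network_def)
  have W1: "W 1 \<in> carrier_mat (d 1) n" and b1: "b 1 \<in> carrier_vec (d 1)"
    using layers[rule_format, of 1] l d0 by simp_all
  have "W 1 *\<^sub>v 0\<^sub>v n = 0\<^sub>v (d 1)" using W1 by (intro eq_vecI) auto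
  then have vs1_eq: "vs1 = b 1" using b1 by (simp add: vs1 layer_in_def)
  have v: "(W 1 *\<^sub>v x + b 1) $ i = (W 1 *\<^sub>v x) $ i + vs1 $ i" if "i < d 1" for i
    using that b1 by (simp add: vs1_eq)
  have vle: "vs1 $ i \<le> vhi1 $ i" if "i < d 1" for i
    using vhi1 that by (simp add: less_eq_vec_def)
  have dev: "\<bar>(W 1 *\<^sub>v x) $ i\<bar> \<le> vhi1 $ i - vs1 $ i" if "i < d 1" for i
    using bound_lmi_imp_abs_le[OF lmi[rule_format, OF that] W1 that P x vle[OF that]] .
  have "vlo1 \<le> W 1 *\<^sub>v x + b 1"
    unfolding less_eq_vec_def
  proof (intro conjI allI impI)
    show "dim_vec vlo1 = dim_vec (W 1 *\<^sub>v x + b 1)" using vhi1(1) b1 by (simp add: vlo1)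
    fix i assume "i < dim_vec (W 1 *\<^sub>v x + b 1)"
    then have i: "i < d 1" using b1 by simp
    have "vlo1 $ i = 2 * vs1 $ i - vhi1 $ i" using i vhi1(1) b1 by (simp add: vlo1 vs1_eq)
    then show "vlo1 $ i \<le> (W 1 *\<^sub>v x + b 1) $ i" using v[OF i] dev[OF i] by linarith
  qed
  moreover have "W 1 *\<^sub>v x + b 1 \<le> vhi1"
    unfolding less_eq_vec_def
  proof (intro conjI allI impI)
    show "dim_vec (W 1 *\<^sub>v x + b 1) = dim_vec vhi1" using vhi1(1) b1 by simp
    fix i assume "i < dim_vec vhi1"
    then have i: "i < d 1" using vhi1(1) by simp
    show "(W 1 *\<^sub>v x + b 1) $ i \<le> vhi1 $ i" using v[OF i] dev[OF i] by linarith
  qed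
  ultimately show "vlo \<le> v_phi l W b \<phi> x" "v_phi l W b \<phi> x \<le> vhi"
    using propagation x(1) by blast+
qed

lemma sector_sum_nonneg:
  fixes l :: nat
  assumes net: "network n m l d W b" and x: "x \<in> carrier_vec n"
    and sector: "\<forall>i < nphi d l. sector_bounded \<phi> (\<alpha> $ i) (\<beta> $ i) (v_phi l W b \<phi> (0\<^sub>v n) $ i) (vlo $ i) (vhi $ i)"
    and v: "vlo \<le> v_phi l W b \<phi> x" "v_phi l W b \<phi> x \<le> vhi"
    and lam: "0\<^sub>v (nphi d l) \<le> lam"
  defines "\<Delta>v \<equiv> v_phi l W b \<phi> x - v_phi l W b \<phi> (0\<^sub>v n)" and "\<Delta>w \<equiv> w_phi l W b \<phi> x - w_phi l W b \<phi> (0\<^sub>v n)"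
  shows "0 \<le> (\<Sum>i<nphi d l. lam $ i * ((\<beta> $ i * \<Delta>v $ i - \<Delta>w $ i) * (\<Delta>w $ i - \<alpha> $ i * \<Delta>v $ i)))"
proof (rule sum_nonneg)
  fix i assume "i \<in> {..<nphi d l}"
  then have i: "i < nphi d l" by simp
  have dims: "dim_vec (v_phi l W b \<phi> x) = nphi d l" "dim_vec (v_phi l W b \<phi> (0\<^sub>v n)) = nphi d l"
    using v_phi_carrier[OF net] by auto
  have lam_i: "0 \<le> lam $ i" using lam i by (auto simp: less_eq_vec_def)
  define s where "s = v_phi l W b \<phi> x $ i"
  define s0 where "s0 = v_phi l W b \<phi> (0\<^sub>v n) $ i"
  have "s \<in> {vlo $ i..vhi $ i}" using v i dims by (auto simp: less_eq_vec_def s_def)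
  then have "(\<phi> s - \<phi> s0 - \<alpha> $ i * (s - s0)) * (\<phi> s - \<phi> s0 - \<beta> $ i * (s - s0)) \<le> 0"
    using sector i unfolding sector_bounded_def s0_def by blast
  moreover have "\<Delta>v $ i = s - s0" "\<Delta>w $ i = \<phi> s - \<phi> s0"
    using i dims by (simp_all add: \<Delta>v_def \<Delta>w_def s_def s0_def w_phi_eq_map_v_phi)
  ultimately have "(\<Delta>w $ i - \<alpha> $ i * \<Delta>v $ i) * (\<Delta>w $ i - \<beta> $ i * \<Delta>v $ i) \<le> 0" by simp
  moreover have flip: "(\<beta> $ i * \<Delta>v $ i - \<Delta>w $ i) * (\<Delta>w $ i - \<alpha> $ i * \<Delta>v $ i) =
      - ((\<Delta>w $ i - \<alpha> $ i * \<Delta>v $ i) * (\<Delta>w $ i - \<beta> $ i * \<Delta>v $ i))"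
    by (simp add: algebra_simps)
  ultimately have "0 \<le> (\<beta> $ i * \<Delta>v $ i - \<Delta>w $ i) * (\<Delta>w $ i - \<alpha> $ i * \<Delta>v $ i)"
    unfolding flip by simp
  with lam_i show "0 \<le> lam $ i * ((\<beta> $ i * \<Delta>v $ i - \<Delta>w $ i) * (\<Delta>w $ i - \<alpha> $ i * \<Delta>v $ i))"
    by (rule mult_nonneg_nonneg)
qed

section \<open>Robust stability and region of attraction\<close>

theorem theorem1:
  fixes n m l :: nat and d :: "nat \<Rightarrow> nat"
    and W :: "nat \<Rightarrow> real mat" and b :: "nat \<Rightarrow> real Matrix.vec" and \<phi> :: "real \<Rightarrow> real"
    and Alo Ahi Blo Bhi P :: "real mat"
    and xs vs vs1 vlo1 vhi1 vlo vhi \<alpha> \<beta> lam :: "real Matrix.vec"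
  assumes network: "network n m l d W b"
    and xs: "xs = 0\<^sub>v n"
    and pi_zero: "nn l W b \<phi> xs = 0\<^sub>v m"
    and A_dims: "Alo \<in> carrier_mat n n" "Ahi \<in> carrier_mat n n" "Alo \<le> Ahi"
    and B_dims: "Blo \<in> carrier_mat n m" "Bhi \<in> carrier_mat n m" "Blo \<le> Bhi"
    and vs: "vs = v_phi l W b \<phi> xs"
    and vs1: "vs1 = layer_in W b \<phi> 1 xs"
    and vhi1: "vhi1 \<in> carrier_vec (d 1)" "vs1 \<le> vhi1"
    and vlo1: "vlo1 = 2 \<cdot>\<^sub>v vs1 - vhi1"
    and bounds: "vlo \<in> carrier_vec (nphi d l)" "vhi \<in> carrier_vec (nphi d l)" "vlo \<le> vs" "vs \<le> vhi"
    and first_block: "vec_first vlo (d 1) = vlo1" "vec_first vhi (d 1) = vhi1"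
    and propagation: "\<forall>x \<in> carrier_vec n. vlo1 \<le> W 1 *\<^sub>v x + b 1 \<and> W 1 *\<^sub>v x + b 1 \<le> vhi1 \<longrightarrow>
           vlo \<le> v_phi l W b \<phi> x \<and> v_phi l W b \<phi> x \<le> vhi"
    and sector_dims: "\<alpha> \<in> carrier_vec (nphi d l)" "\<beta> \<in> carrier_vec (nphi d l)" "\<alpha> \<le> \<beta>"
    and sector: "\<forall>i < nphi d l. sector_bounded \<phi> (\<alpha> $ i) (\<beta> $ i) (vs $ i) (vlo $ i) (vhi $ i)"
    and P: "P \<in> carrier_mat n n" "pos_def P"
    and lam: "lam \<in> carrier_vec (nphi d l)" "0\<^sub>v (nphi d l) \<le> lam"
    and lmi1: "\<forall>i < d 1. pos_semidef (bound_lmi W vhi1 vs1 P i)"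
    and lmi2: "\<forall>A \<in> interval_vertices Alo Ahi. \<forall>B \<in> interval_vertices Blo Bhi.
           neg_def (stability_lmi n m l d W \<alpha> \<beta> lam P A B)"
  shows "locally_stable n (nn l W b \<phi>) Alo Ahi Blo Bhi xs \<and>
         ellipsoid n P xs \<subseteq> robust_roa n (nn l W b \<phi>) Alo Ahi Blo Bhi xs"
proof -
  let ?\<pi> = "nn l W b \<phi>"
  note dims = sector_dims(1,2) lam(1)
  have "lyapunov_stable n ?\<pi> A B xs \<and> (\<forall>x0 \<in> ellipsoid n P xs. vec_tendsto (solution ?\<pi> A B x0) xs)"
    if A: "A \<in> {Alo..Ahi}" and B: "B \<in> {Blo..Bhi}" for A B
  proof -
    have Ac: "A \<in> carrier_mat n n" and Bc: "B \<in> carrier_mat n m"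
      using interval_mat_carrier A B A_dims(1) B_dims(1) by blast+
    define k where "k = n + nphi d l + n"
    define L where "L = stability_lmi n m l d W \<alpha> \<beta> lam P A B"
    have L: "L \<in> carrier_mat k k"
      unfolding L_def k_def
      by (rule stability_lmi_quadratic_form(1)[OF network dims P(1) Ac Bc, of "0\<^sub>v n" "0\<^sub>v (nphi d l)" "0\<^sub>v n"]) simp_all
    then have L': "- L \<in> carrier_mat k k" by simp
    have "0 < z \<bullet> (- L *\<^sub>v z)" if "z \<in> carrier_vec k" "z \<noteq> 0\<^sub>v k" for z
      using stability_lmi_vertices_imp_interval[OF network dims P(1) A_dims(1,2) B_dims(1,2) lmi2 A B] that
      unfolding L_def k_def by blast
    then obtain \<mu> where \<mu>: "0 < \<mu>" "\<And>z. z \<in> carrier_vec k \<Longrightarrow> \<mu> * (z \<bullet> z) \<le> z \<bullet> (- L *\<^sub>v z)"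
      using pos_form_coercive[OF L'] by blast
    have closed: "closed_loop ?\<pi> A B x \<in> carrier_vec n" for x
      using Ac Bc by (intro carrier_vecI) (simp add: closed_loop_def)
    have decr: "closed_loop ?\<pi> A B x \<bullet> (P *\<^sub>v closed_loop ?\<pi> A B x) \<le> x \<bullet> (P *\<^sub>v x) - \<mu> * (x \<bullet> x)"
      if x: "x \<in> carrier_vec n" and ell: "x \<bullet> (P *\<^sub>v x) \<le> 1" for x
    proof -
      define y where "y = closed_loop ?\<pi> A B x"
      define w where "w = w_phi l W b \<phi> x - w_phi l W b \<phi> (0\<^sub>v n)"
      define z where "z = (x @\<^sub>v w) @\<^sub>v y"
      define S where "S = (\<Sum>i<nphi d l. lam $ i *
        ((\<beta> $ i * (v_phi l W b \<phi> x - v_phi l W b \<phi> (0\<^sub>v n)) $ i - w $ i) *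
         (w $ i - \<alpha> $ i * (v_phi l W b \<phi> x - v_phi l W b \<phi> (0\<^sub>v n)) $ i)))"
      have w: "w \<in> carrier_vec (nphi d l)"
        unfolding w_def using w_phi_carrier[OF network] x by simp
      have y: "y \<in> carrier_vec n" unfolding y_def by (rule closed)
      have z: "z \<in> carrier_vec k" unfolding z_def k_def using x w y by simp
      note incr = network_increments[OF network x pi_zero[unfolded xs], folded w_def]
      have y_eq: "A *\<^sub>v x + B *\<^sub>v (N_ux n m *\<^sub>v x + N_uw m l d W *\<^sub>v w) = y"
        unfolding incr(2)[symmetric] y_def closed_loop_def ..
      have S: "0 \<le> S"
        unfolding S_def w_def
        by (rule sector_sum_nonneg[OF network x sector[unfolded vs xs]
              ellipsoid_imp_v_phi_bounds[OF network vs1[unfolded xs] vhi1 vlo1 propagation P(1) lmi1 x ell] lam(2)])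
      have "z \<bullet> (L *\<^sub>v z) = - (x \<bullet> (P *\<^sub>v x)) + 2 * S + 2 * (y \<bullet> (P *\<^sub>v y)) - y \<bullet> (P *\<^sub>v y)"
        using stability_lmi_quadratic_form(2)[OF network dims P(1) Ac Bc x w y]
        unfolding y_eq incr(1)[symmetric] S_def L_def z_def .
      moreover have "\<mu> * (z \<bullet> z) \<le> - (z \<bullet> (L *\<^sub>v z))"
        using \<mu>(2)[OF z] unfolding scalar_prod_uminus_mat[OF L z z] .
      moreover have "\<mu> * (x \<bullet> x) \<le> \<mu> * (z \<bullet> z)"
      proof -
        have "z \<bullet> z = x \<bullet> x + w \<bullet> w + y \<bullet> y"
          unfolding z_def using x w y
          by (simp add: scalar_prod_append[of _ "n + nphi d l" _ n] scalar_prod_append[of _ n _ "nphi d l"])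
        then show ?thesis using \<mu>(1) scalar_prod_self_nonneg[of w] scalar_prod_self_nonneg[of y] by simp
      qed
      \<comment> \<open>As \<open>y\<close> is the successor state, the cross term is \<open>2 V y\<close>, of which \<open>- V y\<close> leaves \<open>V y\<close>.\<close>
      ultimately show ?thesis using S unfolding y_def by linarith
    qed
    show ?thesis
      using lyapunov_decrease_imp_stable_and_attracting[OF P closed \<mu>(1) decr] unfolding xs by blast
  qed
  then show ?thesis
    unfolding locally_stable_def robust_roa_def by (auto simp: ellipsoid_def)
qed

end
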